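(* Let $r,\ell_1,\ldots,\ell_r$ be positive integers and $n=\ell_1+\cdots+\ell_r$. Consider the factors $$\prod_{j=1}^{r}\left(\lambda-\sum_{k=1}^{n}a_k\,b_k^{j}\,e^{-\lambda\tau_k}\right)$$ of a characteristic function, where the constants $b_k^{j}\in\mathbb{R}\setminus\{0\}$ are fixed for all $j=1,\ldots,r$, $k=1,\ldots,n$, and suppose that $\det\mathcal{I}_B\neq 0$, where $\mathcal{I}_B$ is the $n\times n$ matrix built from the $b_k^j$ and $\ell_1,\ldots,\ell_r$ as described in the context. Suppose that the $n$ numbers $$\omega_1^1,\ldots,\omega_{\ell_1}^1,\ \omega_1^2,\ldots,\omega_{\ell_2}^2,\ \ldots,\ \omega_1^r,\ldots,\omega_{\ell_r}^r$$ are positive and linearly independent over the rationals. Then there exist $\tau_1>0,\ldots,\tau_n>0$ and $a_1,\ldots,a_n\in\mathbb{R}$ such that for all $j=1,\ldots,r$ the equation $$\lambda-\sum_{k=1}^{n}a_k\,b_k^{j}\,e^{-\lambda\tau_k}=0$$ has roots $\lambda=i\omega_\ell^{j}$ for $\ell=1,\ldots,\ell_j$.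
   Context: Superscripts on $b_k^j$ and $\omega_\ell^j$ are indices, not powers. Put $\mu_0:=0$ and $\mu_j:=\sum_{i=1}^{j}\ell_i$, so $\mu_r=n$. For $j=1,\ldots,r$ let $A_j$ be the $\ell_j\times n$ matrix whose entry in row $p$ ($1\leq p\leq\ell_j$) and column $k$ ($1\leq k\leq n$) is $$(A_j)_{pk}=\begin{cases}-b_k^{j} & \text{if } \mu_j-p+2\leq k\leq\mu_j,\\ \ \ b_k^{j} & \text{otherwise.}\end{cases}$$ Thus the first row of $A_j$ is $(b_1^j,\ldots,b_n^j)$, the second row differs from it by a sign change in column $\mu_j$, and so on, until the last row, which differs from the first by sign changes in columns $2+\mu_{j-1},\ldots,\mu_j$. The $n\times n$ matrix $\mathcal{I}_B$ is obtained by stacking $A_1,A_2,\ldots,A_r$ vertically, in this order. *)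

theory Defs
  imports Complex_Main "Jordan_Normal_Form.Determinant"
begin

text \<open>
  Indices are 1-based: \<open>b j k\<close> is $b_k^j$ and \<open>\<omega> j l\<close> is $\omega_l^j$, with \<open>j\<close> ranging over
  \<open>{1..r}\<close>, \<open>k\<close> over \<open>{1..n}\<close> and \<open>l\<close> over \<open>{1..ell j}\<close>; values outside these ranges are irrelevant.
\<close>

definition block_end :: "(nat \<Rightarrow> nat) \<Rightarrow> nat \<Rightarrow> nat" where
  "block_end ell j = (\<Sum>i=1..j. ell i)"

text \<open>
  Matrix entries are 0-based in the library, so position \<open>(p', k')\<close> holds the entry in row
  \<open>p = p' + 1\<close> and column \<open>k = k' + 1\<close>. The condition \<open>\<mu> - p + 2 \<le> k\<close> is written without
  subtraction.
\<close>

definition sign_block :: "nat \<Rightarrow> (nat \<Rightarrow> nat) \<Rightarrow> (nat \<Rightarrow> nat \<Rightarrow> real) \<Rightarrow> nat \<Rightarrow> real mat" where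
  "sign_block n ell b j = mat (ell j) n (\<lambda>(p', k').
     let p = p' + 1; k = k' + 1
     in if block_end ell j + 2 \<le> k + p \<and> k \<le> block_end ell j then - b j k else b j k)"

definition I_B :: "nat \<Rightarrow> (nat \<Rightarrow> nat) \<Rightarrow> (nat \<Rightarrow> nat \<Rightarrow> real) \<Rightarrow> real mat" where
  "I_B r ell b = (let n = block_end ell r in
     mat_of_rows n (concat (map (\<lambda>j. rows (sign_block n ell b j)) [1..<r + 1])))"

text \<open>The library determinant is 0 on non-square matrices, so squareness matters.\<close>

lemma I_B_carrier: "I_B r ell b \<in> carrier_mat (block_end ell r) (block_end ell r)"
proof -
  have 1: "sum_list (map ell [1..<r + 1]) = block_end ell r"
    unfolding interv_sum_list_conv_sum_set_nat block_end_def
    by (rule sum.cong) auto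
  have 2: "length (rows (sign_block n ell b j)) = ell j" for n j
    by (simp add: sign_block_def)
  show ?thesis
    unfolding I_B_def Let_def
    by (rule carrier_matI) (simp_all only: mat_of_rows_carrier length_concat map_map comp_def 1 2)
qed

definition char_factor ::
  "nat \<Rightarrow> (nat \<Rightarrow> real) \<Rightarrow> (nat \<Rightarrow> real) \<Rightarrow> (nat \<Rightarrow> real) \<Rightarrow> complex \<Rightarrow> complex" where
  "char_factor n a c \<tau> z =
     z - (\<Sum>k=1..n. complex_of_real (a k) * complex_of_real (c k) * exp (- z * complex_of_real (\<tau> k)))"

text \<open>
  Linear independence over the rationals of a family (not merely of its set of values, hence the
  injectivity): the reals are viewed as a vector space over \<^typ>\<open>rat\<close>.
\<close>

definition rat_independent_family :: "('i \<Rightarrow> real) \<Rightarrow> 'i set \<Rightarrow> bool" where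
  "rat_independent_family x S \<longleftrightarrow>
     inj_on x S \<and> module.independent (\<lambda>(q::rat) (y::real). of_rat q * y) (x ` S)"

end

theory Submission imports Defs "HOL-Analysis.Kronecker_Approximation_Theorem" begin

text \<open>
  By Kronecker's theorem the phases $e^{-i\omega_m\tau_k}$ can be brought arbitrarily close to any
  prescribed unit numbers. It therefore suffices to solve the system exactly with free phases, at a
  point where all $a_k \neq 0$ and where the linearisation in $(a_k, \tau_k)$ is invertible: a
  contraction argument then turns approximate phases into an exact solution. At the sign pattern of
  $\mathcal{I}_B$ the linearisation decouples into two copies of $\mathcal{I}_B$, so it is invertible
  there and nearby, but the amplitudes $a = \mathcal{I}_B^{-1}(\pm\omega_m)_m$ may have zero entries.
  If some choice of signs leaves at least two nonzero entries, a small perturbation removes the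
  zeros; the only other case with $n \geq 2$ has $n = 2$ and is solved by an explicit configuration.
\<close>

text \<open>There are \<open>2n\<close> real equations for \<open>2n\<close> real unknowns, so no
  parameter is left to spare. A delay acts on its term only through \<open>a k\<close>: the
  derivative in \<open>\<tau> k\<close> is a multiple of it. A vanishing amplitude would therefore
  cost one unknown, which is why zeros have to be removed. With the delay corrected by
  \<open>- v k / a k\<close>, the term becomes \<open>a k + x k + \<i> * \<omega> m * v k\<close> up
  to higher order. Once a row is turned by its common phase, its real part is the sign matrix
  applied to \<open>x\<close>, and its imaginary part is \<open>\<omega> m\<close> times the sign
  matrix applied to \<open>v\<close>; this is the source of the two copies. The times from
  Kronecker's theorem come without an upper bound, but the estimates do not see them: only a unit
  factor of each term depends on the time, so every tolerance can be fixed before the times are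
  chosen.\<close>

section \<open>Contraction principle in the supremum over coordinates\<close>

text \<open>Banach's theorem carried out on plain functions: values outside \<open>S\<close> are
  left free, and a bound \<open>d\<close> valid on all of \<open>S\<close> replaces the distance. A
  first step of at most \<open>\<delta> / 2\<close> and the factor 1/2 keep the iterates in the ball
  of radius \<open>\<delta>\<close>, since all steps together add up to at most
  \<open>\<delta>\<close>.\<close>

lemma coordinatewise_contraction_fixpoint:
  fixes G :: "('i \<Rightarrow> complex) \<Rightarrow> 'i \<Rightarrow> complex"
  assumes "\<delta> \<ge> 0"
    and lip: "\<And>p q d. \<lbrakk>\<forall>m\<in>S. norm (p m) \<le> \<delta>; \<forall>m\<in>S. norm (q m) \<le> \<delta>;
                \<forall>m\<in>S. norm (p m - q m) \<le> d\<rbrakk> \<Longrightarrow> \<forall>m\<in>S. norm (G p m - G q m) \<le> d / 2"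
    and start: "\<forall>m\<in>S. norm (G (\<lambda>_. 0) m) \<le> \<delta> / 2"
  obtains q where "\<forall>m\<in>S. norm (q m) \<le> \<delta>" "\<forall>m\<in>S. G q m = q m"
proof -
  define x where "x i = (G ^^ i) (\<lambda>_. 0)" for i
  have x0: "x 0 = (\<lambda>_. 0)" and xS: "x (Suc i) = G (x i)" for i
    by (simp_all add: x_def)
  have step: "(\<forall>m\<in>S. norm (x i m) \<le> \<delta> * (1 - (1/2)^i)) \<and>
              (\<forall>m\<in>S. norm (x (Suc i) m - x i m) \<le> \<delta> / 2 * (1/2)^i)" for i
  proof (induction i)
    case 0
    then show ?case using start by (simp add: x0 xS)
  next
    case (Suc i)
    have half: "\<delta> * (1 - (1/2)^j) \<le> \<delta>" for j
      using \<open>\<delta> \<ge> 0\<close> by (simp add: mult_left_le)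
    have A: "\<forall>m\<in>S. norm (x (Suc i) m) \<le> \<delta> * (1 - (1/2)^Suc i)"
    proof
      fix m assume "m \<in> S"
      then have "norm (x i m) \<le> \<delta> * (1 - (1/2)^i)" "norm (x (Suc i) m - x i m) \<le> \<delta> / 2 * (1/2)^i"
        using Suc by blast+
      then have "norm (x (Suc i) m) \<le> \<delta> * (1 - (1/2)^i) + \<delta> / 2 * (1/2)^i"
        using norm_triangle_sub[of "x (Suc i) m" "x i m"] by linarith
      then show "norm (x (Suc i) m) \<le> \<delta> * (1 - (1/2)^Suc i)"
        by (simp add: field_simps)
    qed
    have "\<forall>m\<in>S. norm (G (x (Suc i)) m - G (x i) m) \<le> (\<delta> / 2 * (1/2)^i) / 2"
    proof (rule lip)
      show "\<forall>m\<in>S. norm (x (Suc i) m) \<le> \<delta>" "\<forall>m\<in>S. norm (x i m) \<le> \<delta>"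
        using A Suc half by (blast intro: order_trans)+
    qed (use Suc in blast)
    with A show ?case by (simp add: xS)
  qed
  have bounded: "norm (x i m) \<le> \<delta>" if "m \<in> S" for i m
  proof -
    have "norm (x i m) \<le> \<delta> * (1 - (1/2)^i)" using step that by blast
    also have "\<dots> \<le> \<delta>" using \<open>\<delta> \<ge> 0\<close> by (simp add: mult_left_le)
    finally show ?thesis .
  qed
  have conv: "convergent (\<lambda>i. x i m)" if "m \<in> S" for m
  proof -
    have "summable (\<lambda>i. \<delta> / 2 * (1/2)^i)" by (intro summable_mult summable_geometric) simp
    then have "summable (\<lambda>i. x (Suc i) m - x i m)"
      by (rule summable_comparison_test') (use step that in blast)
    then have "convergent (\<lambda>n. \<Sum>i<n. x (Suc i) m - x i m)"
      by (simp add: summable_iff_convergent)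
    moreover have "(\<Sum>i<n. x (Suc i) m - x i m) = x n m" for n
      using sum_lessThan_telescope[of "\<lambda>i. x i m" n] by (simp add: x0)
    ultimately show ?thesis by simp
  qed
  define q where "q m = lim (\<lambda>i. x i m)" for m
  have lim: "(\<lambda>i. x i m) \<longlonglongrightarrow> q m" if "m \<in> S" for m
    using conv[OF that] by (simp add: q_def convergent_LIMSEQ_iff)
  have qb: "\<forall>m\<in>S. norm (q m) \<le> \<delta>"
    using bounded by (auto intro!: Lim_bounded[OF tendsto_norm[OF lim]])
  \<comment> \<open>Coordinatewise convergence alone would not do: \<open>lip\<close> needs one
    bound for all coordinates at once, so the limit is approached at an explicit rate independent of
    \<open>m\<close>.\<close>
  have tail: "norm (x (i + k) m - x i m) \<le> \<delta> * (1/2)^i" if "m \<in> S" for i k m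
  proof -
    have "norm (x (i + k) m - x i m) \<le> \<delta> * (1/2)^i * (1 - (1/2)^k)"
    proof (induction k)
      case (Suc k)
      have "norm (x (i + Suc k) m - x i m)
          \<le> norm (x (Suc (i + k)) m - x (i + k) m) + norm (x (i + k) m - x i m)"
        using norm_triangle_ineq[of "x (Suc (i + k)) m - x (i + k) m" "x (i + k) m - x i m"] by simp
      also have "\<dots> \<le> \<delta> / 2 * (1/2)^(i+k) + \<delta> * (1/2)^i * (1 - (1/2)^k)"
        using step that Suc by (intro add_mono) blast+
      also have "\<dots> = \<delta> * (1/2)^i * (1 - (1/2)^Suc k)"
        by (simp add: field_simps power_add)
      finally show ?case .
    qed simp
    also have "\<dots> \<le> \<delta> * (1/2)^i" using \<open>\<delta> \<ge> 0\<close> by (simp add: mult_left_le)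
    finally show ?thesis .
  qed
  have dist_q: "\<forall>m\<in>S. norm (q m - x i m) \<le> \<delta> * (1/2)^i" for i
  proof
    fix m assume "m \<in> S"
    have "(\<lambda>k. norm (x (i + k) m - x i m)) \<longlonglongrightarrow> norm (q m - x i m)"
      using LIMSEQ_ignore_initial_segment[OF lim[OF \<open>m \<in> S\<close>], of i]
      by (intro tendsto_intros) (simp add: add.commute)
    then show "norm (q m - x i m) \<le> \<delta> * (1/2)^i"
      by (rule Lim_bounded[where M = 0]) (intro allI impI tail[OF \<open>m \<in> S\<close>])
  qed
  have "G q m = q m" if "m \<in> S" for m
  proof -
    have "\<forall>m\<in>S. norm (G q m - G (x i) m) \<le> \<delta> * (1/2)^i / 2" for i
      by (rule lip[OF qb _ dist_q]) (use bounded in blast)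
    then have "norm (G q m - x (Suc i) m) \<le> \<delta> * (1/2)^i / 2" for i
      using that unfolding xS by blast
    then have bound: "\<forall>\<^sub>F i in sequentially. norm (G q m - x (Suc i) m) \<le> \<delta> / 2 * (1/2)^i"
      by (intro always_eventually) simp
    have "(\<lambda>i. \<delta> / 2 * (1/2)^i) \<longlonglongrightarrow> \<delta> / 2 * 0"
      by (intro tendsto_mult tendsto_const LIMSEQ_power_zero) simp
    then have "(\<lambda>i. G q m - x (Suc i) m) \<longlonglongrightarrow> 0"
      using Lim_null_comparison[OF bound] by simp
    from tendsto_diff[OF tendsto_const[of "G q m"] this]
    have "(\<lambda>i. x (Suc i) m) \<longlonglongrightarrow> G q m" by simp
    moreover have "(\<lambda>i. x (Suc i) m) \<longlonglongrightarrow> q m"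
      using lim[OF that] by (rule LIMSEQ_Suc)
    ultimately show ?thesis by (rule LIMSEQ_unique)
  qed
  with qb show thesis using that by blast
qed

section \<open>Strict differentiability of the exponential terms\<close>

text \<open>\<open>exp z - z\<close> has derivative \<open>exp z - 1\<close>, which is small near 0,
  and the mean value inequality on a disc compares any two of its points. A contraction needs this
  two-point form of differentiability.\<close>

lemma exp_strictly_differentiable_at_0:
  fixes \<kappa> :: real
  assumes "\<kappa> > 0"
  obtains r where "r > 0"
    "\<And>z w :: complex. \<lbrakk>norm z \<le> r; norm w \<le> r\<rbrakk> \<Longrightarrow> norm (exp z - exp w - (z - w)) \<le> \<kappa> * norm (z - w)"
proof -
  have "isCont (exp :: complex \<Rightarrow> complex) 0" by simp
  then obtain s where "s > 0" and s: "\<And>z :: complex. norm z < s \<Longrightarrow> norm (exp z - 1) < \<kappa>"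
    using assms unfolding continuous_at_eps_delta by (auto simp: dist_norm)
  have "norm ((exp z - z) - (exp w - w)) \<le> \<kappa> * norm (z - w)" if "norm z \<le> s/2" "norm w \<le> s/2" for z w :: complex
  proof (rule field_differentiable_bound[where S = "cball 0 (s/2)"])
    show "((\<lambda>z. exp z - z) has_field_derivative exp z - 1) (at z within cball 0 (s/2))" for z :: complex
      by (auto intro!: derivative_eq_intros)
    show "norm (exp z - 1) \<le> \<kappa>" if "z \<in> cball 0 (s/2)" for z :: complex
      using s[of z] that \<open>s > 0\<close> by simp
  qed (use that in auto)
  then show thesis
    using that[of "s/2"] \<open>s > 0\<close> by (auto simp: algebra_simps)
qed

text \<open>Dividing the phase shift by \<open>a\<close> makes the linear part in \<open>v\<close>
  equal to \<open>\<i> * w * v\<close> whatever \<open>a\<close> is. What remains, \<open>h\<close>,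
  has an arbitrarily small Lipschitz constant near the origin. The form with
  \<open>\<forall>\<^sub>F\<close> lets finitely many such estimates share one radius.\<close>

lemma exp_product_strictly_differentiable:
  fixes a w \<kappa> :: real
  assumes "a \<noteq> 0" "\<kappa> > 0"
  defines "h \<equiv> \<lambda>x v. complex_of_real (a + x) * exp (\<i> * of_real (w * v / a)) - (of_real x + \<i> * of_real (w * v))"
  shows "\<forall>\<^sub>F \<delta> in at_right 0. \<forall>x v x' v'. \<bar>x\<bar> \<le> \<delta> \<longrightarrow> \<bar>v\<bar> \<le> \<delta> \<longrightarrow> \<bar>x'\<bar> \<le> \<delta> \<longrightarrow> \<bar>v'\<bar> \<le> \<delta> \<longrightarrow>
     norm (h x v - h x' v') \<le> \<kappa> * (\<bar>x - x'\<bar> + \<bar>v - v'\<bar>)"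
proof -
  define \<theta> where "\<theta> = w / a"
  define \<kappa>' where "\<kappa>' = min 1 (\<kappa> / (2 * (\<bar>w\<bar> + 1)))"
  have "\<kappa>' > 0" "\<kappa>' \<le> 1" using assms by (auto simp: \<kappa>'_def)
  have \<kappa>': "\<bar>w\<bar> * \<kappa>' \<le> \<kappa> / 2"
  proof -
    have "\<bar>w\<bar> * \<kappa>' \<le> (\<bar>w\<bar> + 1) * (\<kappa> / (2 * (\<bar>w\<bar> + 1)))"
      using \<open>\<kappa>' > 0\<close> by (intro mult_mono) (auto simp: \<kappa>'_def)
    also have "\<dots> = \<kappa> / 2" by (simp add: field_simps)
    finally show ?thesis .
  qed
  obtain r where "r > 0" and r: "\<And>z w :: complex. \<lbrakk>norm z \<le> r; norm w \<le> r\<rbrakk>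
      \<Longrightarrow> norm (exp z - exp w - (z - w)) \<le> \<kappa>' * norm (z - w)"
    using exp_strictly_differentiable_at_0[OF \<open>\<kappa>' > 0\<close>] by blast
  have r2: "norm (exp z - exp w) \<le> 2 * norm (z - w)" if "norm z \<le> r" "norm w \<le> r" for z w :: complex
  proof -
    have "norm (exp z - exp w) \<le> \<kappa>' * norm (z - w) + norm (z - w)"
      using r[OF that] norm_triangle_sub[of "exp z - exp w" "z - w"] by simp
    also have "\<dots> \<le> 1 * norm (z - w) + norm (z - w)"
      using \<open>\<kappa>' \<le> 1\<close> by (intro add_mono mult_right_mono) auto
    finally show ?thesis by simp
  qed
  define \<delta>0 where "\<delta>0 = min (r / (\<bar>\<theta>\<bar> + 1)) (\<kappa> / (4 * (\<bar>\<theta>\<bar> + 1)))"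
  have "\<delta>0 > 0" using \<open>r > 0\<close> assms by (auto simp: \<delta>0_def)
  have *: "norm (h x v - h x' v') \<le> \<kappa> * (\<bar>x - x'\<bar> + \<bar>v - v'\<bar>)"
    if "\<delta> > 0" "\<delta> < \<delta>0" "\<bar>x\<bar> \<le> \<delta>" "\<bar>v\<bar> \<le> \<delta>" "\<bar>x'\<bar> \<le> \<delta>" "\<bar>v'\<bar> \<le> \<delta>" for \<delta> x v x' v'
  proof -
    have \<delta>r: "\<bar>\<theta>\<bar> * \<delta> \<le> r"
    proof -
      have "\<bar>\<theta>\<bar> * \<delta> \<le> (\<bar>\<theta>\<bar> + 1) * (r / (\<bar>\<theta>\<bar> + 1))"
        using that by (intro mult_mono) (auto simp: \<delta>0_def)
      also have "\<dots> = r" by (simp add: field_simps)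
      finally show ?thesis .
    qed
    have \<delta>\<kappa>: "\<bar>\<theta>\<bar> * \<delta> \<le> \<kappa> / 4"
    proof -
      have "\<bar>\<theta>\<bar> * \<delta> \<le> (\<bar>\<theta>\<bar> + 1) * (\<kappa> / (4 * (\<bar>\<theta>\<bar> + 1)))"
        using that by (intro mult_mono) (auto simp: \<delta>0_def)
      also have "\<dots> = \<kappa> / 4" by (simp add: field_simps)
      finally show ?thesis .
    qed
    define z z' where "z = \<i> * complex_of_real (\<theta> * v)" and "z' = \<i> * complex_of_real (\<theta> * v')"
    have nz: "norm z = \<bar>\<theta>\<bar> * \<bar>v\<bar>" "norm z' = \<bar>\<theta>\<bar> * \<bar>v'\<bar>"
      by (simp_all add: z_def z'_def norm_mult abs_mult)
    have nzz: "norm (z - z') = \<bar>\<theta>\<bar> * \<bar>v - v'\<bar>"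
    proof -
      have "z - z' = \<i> * complex_of_real (\<theta> * (v - v'))"
        by (simp add: z_def z'_def algebra_simps)
      then show ?thesis by (simp only: norm_mult norm_of_real abs_mult) simp
    qed
    have "\<bar>\<theta>\<bar> * \<bar>v\<bar> \<le> \<bar>\<theta>\<bar> * \<delta>" "\<bar>\<theta>\<bar> * \<bar>v'\<bar> \<le> \<bar>\<theta>\<bar> * \<delta>"
      using that by (simp_all add: mult_left_mono)
    then have zr: "norm z \<le> r" "norm z' \<le> r" and z\<kappa>: "norm z \<le> \<kappa> / 4"
      using \<delta>r \<delta>\<kappa> nz by linarith+
    have w: "w = a * \<theta>" using assms by (simp add: \<theta>_def)
    \<comment> \<open>Product rule for differences: the remainder of \<open>exp\<close> scaled by
      \<open>a\<close>, and two terms that each carry a small factor, \<open>exp z - 1\<close> or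
      \<open>x'\<close>.\<close>
    have "h x v - h x' v' = a * (exp z - exp z' - (z - z')) + (x - x') * (exp z - 1) + x' * (exp z - exp z')"
      using \<open>a \<noteq> 0\<close> by (simp add: h_def z_def z'_def w algebra_simps)
    also have "norm \<dots> \<le> \<bar>a\<bar> * norm (exp z - exp z' - (z - z')) + \<bar>x - x'\<bar> * norm (exp z - 1) + \<bar>x'\<bar> * norm (exp z - exp z')"
      by (intro order_trans[OF norm_triangle_ineq] add_mono)
         (simp_all add: norm_mult del: of_real_diff)
    also have "\<dots> \<le> \<bar>a\<bar> * (\<kappa>' * norm (z - z')) + \<bar>x - x'\<bar> * (2 * (\<kappa> / 4)) + \<delta> * (2 * norm (z - z'))"
      using r[OF zr] r2[OF zr] r2[of z 0] zr z\<kappa> \<open>r > 0\<close> that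
      by (intro add_mono mult_mono) auto
    also have "\<dots> = (\<bar>w\<bar> * \<kappa>' + 2 * (\<bar>\<theta>\<bar> * \<delta>)) * \<bar>v - v'\<bar> + \<kappa> / 2 * \<bar>x - x'\<bar>"
      by (simp add: nzz w abs_mult algebra_simps)
    also have "\<dots> \<le> \<kappa> * \<bar>v - v'\<bar> + \<kappa> * \<bar>x - x'\<bar>"
      using \<kappa>' \<delta>\<kappa> \<open>\<kappa> > 0\<close> by (intro add_mono mult_right_mono) auto
    finally show ?thesis by (simp add: algebra_simps)
  qed
  show ?thesis
    unfolding eventually_at_right_field using \<open>\<delta>0 > 0\<close> * by (intro exI[of _ \<delta>0]) blast
qed

section \<open>Simultaneous approximation of phases\<close>

text \<open>Kronecker's theorem excludes integer relations among frequencies measured in full turns,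
  hence the scaling. An integer relation among the scaled numbers is a rational relation among the
  original ones once the common factor \<open>c\<close> is cancelled.\<close>

lemma int_independent_rescale:
  fixes \<omega> :: "'i \<Rightarrow> real"
  assumes "module.independent (\<lambda>(q::rat) (y::real). of_rat q * y) (\<omega> ` S)" "c \<noteq> 0"
  shows "module.independent (\<lambda>r. (*) (real_of_int r)) ((\<lambda>i. c * \<omega> i) ` S)"
proof -
  interpret Q: Modules.module "\<lambda>(q::rat) (y::real). of_rat q * y"
    by unfold_locales (simp_all add: algebra_simps of_rat_add of_rat_mult)
  interpret Z: Modules.module "\<lambda>r. (*) (real_of_int r)"
    by unfold_locales (simp_all add: algebra_simps)
  show ?thesis
  proof
    assume "Z.dependent ((\<lambda>i. c * \<omega> i) ` S)"
    then obtain A u v where A: "finite A" "A \<subseteq> (\<lambda>i. c * \<omega> i) ` S" and v: "v \<in> A" "u v \<noteq> 0"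
      and sum: "(\<Sum>v\<in>A. real_of_int (u v) * v) = 0"
      unfolding Z.dependent_explicit by blast
    define B where "B = (\<lambda>v. v / c) ` A"
    define w where "w x = (of_int (u (c * x)) :: rat)" for x
    have "finite B" "B \<subseteq> \<omega> ` S" using A \<open>c \<noteq> 0\<close> by (auto simp: B_def)
    moreover have "v / c \<in> B" "w (v / c) \<noteq> 0" using v \<open>c \<noteq> 0\<close> by (auto simp: B_def w_def)
    moreover have "(\<Sum>x\<in>B. of_rat (w x) * x) = 0"
    proof -
      have "(\<Sum>x\<in>B. of_rat (w x) * x) = (\<Sum>v\<in>A. real_of_int (u v) * v / c)"
        unfolding B_def using \<open>c \<noteq> 0\<close>
        by (subst sum.reindex) (auto simp: inj_on_def w_def)
      then show ?thesis using sum by (simp add: sum_divide_distrib[symmetric])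
    qed
    ultimately have "Q.dependent (\<omega> ` S)"
      unfolding Q.dependent_explicit by blast
    with assms show False by blast
  qed
qed

text \<open>Kronecker's theorem produces a time of arbitrary sign; adding a late almost-return time
  from Dirichlet's theorem makes it positive.\<close>

lemma exp_orbit_dense:
  fixes \<omega> :: "nat \<Rightarrow> real" and Z :: "nat \<Rightarrow> complex"
  assumes indep: "rat_independent_family \<omega> {..<n}"
    and Z: "\<forall>m<n. norm (Z m) = 1" and "\<epsilon> > 0"
  obtains T where "T > 1" "\<forall>m<n. norm (exp (- (\<i> * of_real (\<omega> m * T))) - Z m) < \<epsilon>"
proof -
  define \<theta> where "\<theta> m = (- 1 / (2 * pi)) * \<omega> m" for m
  define \<phi> where "\<phi> m = Arg (Z m)" for m
  have \<phi>: "Z m = exp (\<i> * of_real (\<phi> m))" if "m < n" for m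
  proof -
    have "Z m \<noteq> 0" "sgn (Z m) = Z m" using Z that by (auto simp: sgn_eq)
    then show ?thesis by (simp add: \<phi>_def cis_conv_exp[symmetric] cis_Arg)
  qed
  define \<alpha> where "\<alpha> m = \<phi> m / (2 * pi)" for m
  have "isCont (\<lambda>y::real. exp (\<i> * of_real (2 * pi * y))) 0"
    by (intro continuous_intros)
  then obtain \<eta> where "\<eta> > 0" and \<eta>: "\<And>y::real. \<bar>y\<bar> < \<eta> \<Longrightarrow> norm (exp (\<i> * of_real (2 * pi * y)) - 1) < \<epsilon>"
    unfolding continuous_at_eps_delta using \<open>\<epsilon> > 0\<close> by (auto simp: dist_norm)
  have "inj_on \<theta> {..<n}"
    using indep by (auto simp: rat_independent_family_def inj_on_def \<theta>_def)
  moreover have "module.independent (\<lambda>r. (*) (real_of_int r)) (\<theta> ` {..<n})"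
    unfolding \<theta>_def by (rule int_independent_rescale)
      (use indep in \<open>auto simp: rat_independent_family_def\<close>)
  ultimately obtain t h where th: "\<And>i. i < n \<Longrightarrow> \<bar>t * \<theta> i - of_int (h i) - \<alpha> i\<bar> < \<eta> / 2"
    using Kronecker_thm_1[of \<theta> n "\<eta> / 2" \<alpha>] \<open>\<eta> > 0\<close> by auto
  \<comment> \<open>The almost-return time \<open>q\<close>, at least 1, will be used
    \<open>K\<close> times, so that \<open>t + K * q\<close> exceeds 1 whatever the sign of
    \<open>t\<close>. The errors then accumulate to at most \<open>K / N\<close>, which dictates
    \<open>N\<close>.\<close>
  obtain K :: nat where K: "real K > \<bar>t\<bar> + 1" using reals_Archimedean2 by blast
  then have "K > 0" by (auto intro: Nat.gr0I)
  obtain N :: nat where "N > 0" and N: "K / real N < \<eta> / 2"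
  proof -
    obtain N :: nat where N: "real N > 2 * K / \<eta>" using reals_Archimedean2 by blast
    moreover have "2 * K / \<eta> > 0" using \<open>K > 0\<close> \<open>\<eta> > 0\<close> by simp
    ultimately have "N > 0" by (auto intro: Nat.gr0I)
    with N \<open>\<eta> > 0\<close> show thesis by (intro that[of N]) (auto simp: field_simps)
  qed
  obtain q p where "0 < q" and qp: "\<And>i. i < n \<Longrightarrow> \<bar>of_int q * \<theta> i - of_int (p i)\<bar> < 1 / N"
    using Dirichlet_approx_simult[OF \<open>N > 0\<close>] by metis
  define T where "T = t + K * q"
  have "real K * 1 \<le> real K * q" using \<open>0 < q\<close> by (intro mult_left_mono) auto
  with K have "T > 1" by (simp add: T_def)
  moreover have "norm (exp (- (\<i> * of_real (\<omega> m * T))) - Z m) < \<epsilon>" if "m < n" for m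
  proof -
    define k where "k = h m + int K * p m"
    define y where "y = T * \<theta> m - \<alpha> m - of_int k"
    have "\<bar>y\<bar> \<le> \<bar>t * \<theta> m - of_int (h m) - \<alpha> m\<bar> + K * \<bar>of_int q * \<theta> m - of_int (p m)\<bar>"
    proof -
      have "y = (t * \<theta> m - of_int (h m) - \<alpha> m) + K * (of_int q * \<theta> m - of_int (p m))"
        by (simp add: y_def k_def T_def algebra_simps)
      also have "\<bar>\<dots>\<bar> \<le> \<bar>t * \<theta> m - of_int (h m) - \<alpha> m\<bar> + \<bar>K * (of_int q * \<theta> m - of_int (p m))\<bar>"
        by (rule abs_triangle_ineq)
      finally show ?thesis by (simp add: abs_mult)
    qed
    also have "\<dots> < \<eta> / 2 + \<eta> / 2"
    proof (rule add_strict_mono)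
      have "K * \<bar>of_int q * \<theta> m - of_int (p m)\<bar> \<le> K * (1 / N)"
        using qp[OF that] by (intro mult_left_mono) auto
      then show "K * \<bar>of_int q * \<theta> m - of_int (p m)\<bar> < \<eta> / 2" using N by (simp only: times_divide_eq_right mult_1_right)
    qed (rule th[OF that])
    finally have y: "norm (exp (\<i> * of_real (2 * pi * y)) - 1) < \<epsilon>" by (intro \<eta>) simp
    have "- (\<omega> m * T) = 2 * pi * y + \<phi> m + 2 * pi * of_int k"
      by (simp add: y_def \<theta>_def \<alpha>_def field_simps)
    then have "- (\<i> * of_real (\<omega> m * T)) = \<i> * of_real (2 * pi * y) + \<i> * of_real (\<phi> m)
        + \<i> * (of_int k * (of_real pi * 2))"
      by (simp add: complex_eq_iff)
    then have "exp (- (\<i> * of_real (\<omega> m * T))) = exp (\<i> * of_real (2 * pi * y)) * Z m"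
      by (simp only: exp_add exp_2pi_1_int \<phi>[OF that] mult_1_right)
    then have "exp (- (\<i> * of_real (\<omega> m * T))) - Z m = (exp (\<i> * of_real (2 * pi * y)) - 1) * Z m"
      by (simp add: algebra_simps)
    then show ?thesis using y Z that by (simp only: norm_mult)
  qed
  ultimately show thesis using that by blast
qed

section \<open>From approximate phases to an exact solution\<close>

text \<open>The delays are sought as T k - v k / a k with T from Kronecker's theorem, and the
  coefficients as a k + x k. Taking (x, v) = (X q, V q), the defect becomes a near-identity map in q,
  so that a Newton-like iteration converges.\<close>

lemma delay_system_solvable:
  fixes \<beta> :: "nat \<Rightarrow> nat \<Rightarrow> real" and \<omega> a :: "nat \<Rightarrow> real" and Z :: "nat \<Rightarrow> nat \<Rightarrow> complex"
    and X V :: "(nat \<Rightarrow> complex) \<Rightarrow> nat \<Rightarrow> real" and C :: real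
  assumes indep: "rat_independent_family \<omega> {..<n}"
    and Z: "\<forall>m<n. \<forall>k<n. norm (Z m k) = 1"
    and a: "\<forall>k<n. a k \<noteq> 0"
    and base: "\<forall>m<n. (\<Sum>k<n. of_real (a k * \<beta> m k) * Z m k) = \<i> * of_real (\<omega> m)"
    and X_diff: "\<And>p q k. X (\<lambda>m. p m - q m) k = X p k - X q k"
    and V_diff: "\<And>p q k. V (\<lambda>m. p m - q m) k = V p k - V q k"
    and bound: "\<And>q d k. \<forall>m<n. norm (q m) \<le> d \<Longrightarrow> k < n \<Longrightarrow> \<bar>X q k\<bar> \<le> C * d \<and> \<bar>V q k\<bar> \<le> C * d"
    and approx_inverse: "\<And>q d m. \<forall>m<n. norm (q m) \<le> d \<Longrightarrow> m < n \<Longrightarrow>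
      norm (q m - (\<Sum>k<n. of_real (\<beta> m k) * Z m k * (of_real (X q k) + \<i> * of_real (\<omega> m * V q k)))) \<le> d / 4"
  shows "\<exists>\<tau> c. (\<forall>k<n. \<tau> k > 0) \<and>
    (\<forall>m<n. (\<Sum>k<n. of_real (c k * \<beta> m k) * exp (- (\<i> * of_real (\<omega> m * \<tau> k)))) = \<i> * of_real (\<omega> m))"
proof -
  \<comment> \<open>A bound of at least 1 can be divided by: for \<open>q\<close> in the ball of
    radius \<open>\<rho> / D\<close>, both \<open>X q\<close> and \<open>V q\<close> are at most
    \<open>\<rho>\<close>, where the remainder estimate applies.\<close>
  define D where "D = max C 1"
  have "D \<ge> 1" by (simp add: D_def)
  have XV: "\<bar>X q k\<bar> \<le> D * d" "\<bar>V q k\<bar> \<le> D * d" if "\<forall>m<n. norm (q m) \<le> d" "k < n" "d \<ge> 0" for q d k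
    using bound[OF that(1,2)] mult_right_mono[of C D d] that(3) by (auto simp: D_def)
  define W where "W = 1 + (\<Sum>m<n. \<Sum>k<n. \<bar>\<beta> m k\<bar>)"
  define \<Omega> where "\<Omega> = (\<Sum>m<n. \<bar>\<omega> m\<bar>)"
  define A where "A = 1 + (\<Sum>m<n. \<Sum>k<n. \<bar>a k * \<beta> m k\<bar>)"
  have "W \<ge> 1" "A \<ge> 1" "\<Omega> \<ge> 0" by (simp_all add: W_def A_def \<Omega>_def sum_nonneg)
  have row: "(\<Sum>k<n. \<bar>\<beta> m k\<bar>) \<le> W" if "m < n" for m
    using member_le_sum[of m "{..<n}" "\<lambda>m. \<Sum>k<n. \<bar>\<beta> m k\<bar>"] that by (simp add: W_def sum_nonneg)
  have rowA: "(\<Sum>k<n. \<bar>a k * \<beta> m k\<bar>) \<le> A" if "m < n" for m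
    using member_le_sum[of m "{..<n}" "\<lambda>m. \<Sum>k<n. \<bar>a k * \<beta> m k\<bar>"] that by (simp add: A_def sum_nonneg)
  have \<Omega>: "\<bar>\<omega> m\<bar> \<le> \<Omega>" if "m < n" for m
    using member_le_sum[of m "{..<n}" "\<lambda>m. \<bar>\<omega> m\<bar>"] that by (simp add: \<Omega>_def)
  have row_sum: "norm (\<Sum>k<n. of_real (\<beta> m k) * f k) \<le> W * B"
    if "m < n" "\<And>k. k < n \<Longrightarrow> norm (f k) \<le> B" "B \<ge> 0" for m and f :: "nat \<Rightarrow> complex" and B
  proof -
    have "norm (\<Sum>k<n. of_real (\<beta> m k) * f k) \<le> (\<Sum>k<n. \<bar>\<beta> m k\<bar> * B)"
      by (intro sum_norm_le) (use that in \<open>auto simp: norm_mult intro!: mult_left_mono\<close>)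
    also have "\<dots> \<le> W * B"
      using row[OF \<open>m < n\<close>] \<open>B \<ge> 0\<close> by (simp add: sum_distrib_right[symmetric] mult_right_mono)
    finally show ?thesis .
  qed
  \<comment> \<open>Chosen so that the nonlinear remainders of a row contribute
    \<open>W * (\<kappa> * (2 * D * d)) = d / 8\<close> below.\<close>
  define \<kappa> where "\<kappa> = 1 / (16 * W * D)"
  have "\<kappa> > 0" using \<open>W \<ge> 1\<close> \<open>D \<ge> 1\<close> by (simp add: \<kappa>_def)
  define g where "g m k x v = complex_of_real (a k + x) * exp (\<i> * of_real (\<omega> m * v / a k))" for m k x v
  define h where "h m k x v = g m k x v - (of_real x + \<i> * of_real (\<omega> m * v))" for m k x v
  have "\<forall>\<^sub>F \<rho> in at_right 0. \<forall>x v x' v'. \<bar>x\<bar> \<le> \<rho> \<longrightarrow> \<bar>v\<bar> \<le> \<rho> \<longrightarrow> \<bar>x'\<bar> \<le> \<rho> \<longrightarrow> \<bar>v'\<bar> \<le> \<rho> \<longrightarrow>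
     norm (h m k x v - h m k x' v') \<le> \<kappa> * (\<bar>x - x'\<bar> + \<bar>v - v'\<bar>)" if "k < n" for m k
    unfolding h_def g_def using exp_product_strictly_differentiable[of "a k" \<kappa> "\<omega> m"] a that \<open>\<kappa> > 0\<close> by simp
  then have ev1: "\<forall>\<^sub>F \<rho> in at_right 0. \<forall>m\<in>{..<n}. \<forall>k\<in>{..<n}. \<forall>x v x' v'. \<bar>x\<bar> \<le> \<rho> \<longrightarrow> \<bar>v\<bar> \<le> \<rho> \<longrightarrow>
     \<bar>x'\<bar> \<le> \<rho> \<longrightarrow> \<bar>v'\<bar> \<le> \<rho> \<longrightarrow> norm (h m k x v - h m k x' v') \<le> \<kappa> * (\<bar>x - x'\<bar> + \<bar>v - v'\<bar>)"
    by (intro eventually_ball_finite finite_lessThan ballI) simp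
  have "\<forall>\<^sub>F \<rho> in at_right 0. \<rho> < \<bar>a k\<bar>" if "k < n" for k
    using a that by (intro order_tendstoD) (auto intro: tendsto_ident_at)
  then have ev2: "\<forall>\<^sub>F \<rho> in at_right 0. \<forall>k\<in>{..<n}. \<rho> < \<bar>a k\<bar>"
    by (intro eventually_ball_finite finite_lessThan ballI) simp
  have ev3: "\<forall>\<^sub>F \<rho> in at_right (0::real). \<rho> > 0"
    by (simp add: eventually_at_right_less)
  \<comment> \<open>A radius below every \<open>\<bar>a k\<bar>\<close> keeps each correction
    \<open>V q k / a k\<close> below 1 in modulus, so that times \<open>T k > 1\<close> still give
    positive delays.\<close>
  obtain \<rho> :: real where "\<rho> > 0" and \<rho>a: "\<And>k. k < n \<Longrightarrow> \<rho> < \<bar>a k\<bar>"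
    and h_lip: "\<And>m k x v x' v'. \<lbrakk>m < n; k < n; \<bar>x\<bar> \<le> \<rho>; \<bar>v\<bar> \<le> \<rho>; \<bar>x'\<bar> \<le> \<rho>; \<bar>v'\<bar> \<le> \<rho>\<rbrakk>
      \<Longrightarrow> norm (h m k x v - h m k x' v') \<le> \<kappa> * (\<bar>x - x'\<bar> + \<bar>v - v'\<bar>)"
    using eventually_happens'[OF _ eventually_conj[OF ev1 eventually_conj[OF ev2 ev3]]] by auto
  define \<delta> where "\<delta> = \<rho> / D"
  have "\<delta> > 0" "D * \<delta> = \<rho>" using \<open>\<rho> > 0\<close> \<open>D \<ge> 1\<close> by (simp_all add: \<delta>_def)
  \<comment> \<open>The first bound limits to \<open>d / 8\<close> the effect on the linear part of
    replacing \<open>Z\<close> by the attained phases; the second limits the initial defect to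
    \<open>\<delta> / 2\<close>. The times \<open>T\<close> are obtained only afterwards.\<close>
  define \<epsilon> where "\<epsilon> = min (1 / (8 * W * D * (1 + \<Omega>))) (\<delta> / (2 * A))"
  have "\<epsilon> > 0" using \<open>W \<ge> 1\<close> \<open>D \<ge> 1\<close> \<open>\<Omega> \<ge> 0\<close> \<open>A \<ge> 1\<close> \<open>\<delta> > 0\<close> by (simp add: \<epsilon>_def)
  have \<epsilon>1: "W * (\<epsilon> * (D * (1 + \<Omega>))) \<le> 1 / 8"
  proof -
    have "W * (\<epsilon> * (D * (1 + \<Omega>))) = \<epsilon> * (W * D * (1 + \<Omega>))" by simp
    also have "\<dots> \<le> 1 / (8 * W * D * (1 + \<Omega>)) * (W * D * (1 + \<Omega>))"
      using \<open>W \<ge> 1\<close> \<open>D \<ge> 1\<close> \<open>\<Omega> \<ge> 0\<close> by (intro mult_right_mono) (auto simp: \<epsilon>_def)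
    also have "\<dots> = 1 / 8"
    proof -
      have "W \<noteq> 0" "D \<noteq> 0" "1 + \<Omega> \<noteq> 0" using \<open>W \<ge> 1\<close> \<open>D \<ge> 1\<close> \<open>\<Omega> \<ge> 0\<close> by linarith+
      then show ?thesis by simp
    qed
    finally show ?thesis .
  qed
  have \<epsilon>2: "A * \<epsilon> \<le> \<delta> / 2"
  proof -
    have "A * \<epsilon> \<le> A * (\<delta> / (2 * A))"
      using \<open>A \<ge> 1\<close> by (intro mult_left_mono) (auto simp: \<epsilon>_def)
    also have "\<dots> = \<delta> / 2" using \<open>A \<ge> 1\<close> by simp
    finally show ?thesis .
  qed
  have "\<exists>T. T > 1 \<and> (\<forall>m<n. norm (exp (- (\<i> * of_real (\<omega> m * T))) - Z m k) < \<epsilon>)" if "k < n" for k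
    using exp_orbit_dense[OF indep, of "\<lambda>m. Z m k" \<epsilon>] Z that \<open>\<epsilon> > 0\<close> by metis
  then obtain T where T: "\<And>k. k < n \<Longrightarrow> T k > 1"
    and TZ: "\<And>m k. \<lbrakk>m < n; k < n\<rbrakk> \<Longrightarrow> norm (exp (- (\<i> * of_real (\<omega> m * T k))) - Z m k) < \<epsilon>"
    by metis
  define E where "E m k = exp (- (\<i> * complex_of_real (\<omega> m * T k)))" for m k
  have nE: "norm (E m k) = 1" for m k by (simp add: E_def)
  have EZ: "norm (Z m k - E m k) \<le> \<epsilon>" if "m < n" "k < n" for m k
    using TZ[OF that] by (simp add: E_def norm_minus_commute)
  define G where "G q m = q m - ((\<Sum>k<n. of_real (\<beta> m k) * (E m k * g m k (X q k) (V q k))) - \<i> * of_real (\<omega> m))"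
    for q m
  have contract: "norm (G p m - G q m) \<le> d / 2"
    if p: "\<forall>m<n. norm (p m) \<le> \<delta>" and q: "\<forall>m<n. norm (q m) \<le> \<delta>"
      and pq: "\<forall>m<n. norm (p m - q m) \<le> d" and "m < n" for p q d m
  proof -
    have "d \<ge> 0" using pq \<open>m < n\<close> norm_ge_zero order_trans by blast
    define x where "x k = X p k - X q k" for k
    define v where "v k = V p k - V q k" for k
    define L where "L k = complex_of_real (x k) + \<i> * of_real (\<omega> m * v k)" for k
    define H where "H k = h m k (X p k) (V p k) - h m k (X q k) (V q k)" for k
    have x: "\<bar>x k\<bar> \<le> D * d" and v: "\<bar>v k\<bar> \<le> D * d" if "k < n" for k
      using XV[OF pq that \<open>d \<ge> 0\<close>] by (simp_all add: X_diff V_diff x_def v_def)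
    \<comment> \<open>Three errors: \<open>d / 4\<close> from the approximate inverse,
      \<open>d / 8\<close> from the attained phases, \<open>d / 8\<close> from the nonlinear
      remainder. Together they give the contraction factor 1/2.\<close>
    have split: "G p m - G q m = ((p m - q m) - (\<Sum>k<n. of_real (\<beta> m k) * Z m k * L k))
        + (\<Sum>k<n. of_real (\<beta> m k) * ((Z m k - E m k) * L k)) - (\<Sum>k<n. of_real (\<beta> m k) * (E m k * H k))"
    proof -
      have "g m k (X p k) (V p k) - g m k (X q k) (V q k) = H k + L k" for k
        by (simp add: H_def L_def h_def x_def v_def algebra_simps)
      then have *: "(\<Sum>k<n. of_real (\<beta> m k) * (E m k * g m k (X p k) (V p k))) -
          (\<Sum>k<n. of_real (\<beta> m k) * (E m k * g m k (X q k) (V q k))) = (\<Sum>k<n. of_real (\<beta> m k) * (E m k * (H k + L k)))"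
        by (simp add: sum_subtractf[symmetric] right_diff_distrib[symmetric])
      have "G p m - G q m = (p m - q m) - ((\<Sum>k<n. of_real (\<beta> m k) * (E m k * g m k (X p k) (V p k))) -
          (\<Sum>k<n. of_real (\<beta> m k) * (E m k * g m k (X q k) (V q k))))"
        unfolding G_def by (simp add: algebra_simps)
      also note *
      also have "(\<Sum>k<n. of_real (\<beta> m k) * (E m k * (H k + L k))) = (\<Sum>k<n. of_real (\<beta> m k) * Z m k * L k)
        - (\<Sum>k<n. of_real (\<beta> m k) * ((Z m k - E m k) * L k)) + (\<Sum>k<n. of_real (\<beta> m k) * (E m k * H k))"
        by (simp add: sum_subtractf[symmetric] sum.distrib[symmetric] algebra_simps)
      finally show ?thesis by simp
    qed
    have 1: "norm ((p m - q m) - (\<Sum>k<n. of_real (\<beta> m k) * Z m k * L k)) \<le> d / 4"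
      using approx_inverse[OF pq \<open>m < n\<close>] by (simp add: X_diff V_diff L_def x_def v_def)
    have 2: "norm (\<Sum>k<n. of_real (\<beta> m k) * ((Z m k - E m k) * L k)) \<le> d / 8"
    proof -
      have "norm ((Z m k - E m k) * L k) \<le> \<epsilon> * (D * (1 + \<Omega>)) * d" if "k < n" for k
      proof -
        have "norm (L k) \<le> \<bar>x k\<bar> + \<bar>\<omega> m\<bar> * \<bar>v k\<bar>"
          unfolding L_def by (rule order_trans[OF norm_triangle_ineq]) (simp add: norm_mult abs_mult)
        also have "\<dots> \<le> D * d + \<Omega> * (D * d)"
          using x v \<Omega> \<open>\<Omega> \<ge> 0\<close> that \<open>m < n\<close> by (intro add_mono mult_mono) auto
        finally have "norm (L k) \<le> D * (1 + \<Omega>) * d" by (simp add: algebra_simps)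
        then have "norm (Z m k - E m k) * norm (L k) \<le> \<epsilon> * (D * (1 + \<Omega>) * d)"
          using EZ[OF \<open>m < n\<close> that] \<open>\<epsilon> > 0\<close> by (intro mult_mono) auto
        then show ?thesis by (simp only: norm_mult mult.assoc)
      qed
      then have "norm (\<Sum>k<n. of_real (\<beta> m k) * ((Z m k - E m k) * L k)) \<le> W * (\<epsilon> * (D * (1 + \<Omega>)) * d)"
        using \<open>\<epsilon> > 0\<close> \<open>D \<ge> 1\<close> \<open>\<Omega> \<ge> 0\<close> \<open>d \<ge> 0\<close> by (intro row_sum \<open>m < n\<close>) auto
      also have "\<dots> = W * (\<epsilon> * (D * (1 + \<Omega>))) * d" by simp
      also have "\<dots> \<le> 1 / 8 * d" by (intro mult_right_mono \<epsilon>1 \<open>d \<ge> 0\<close>)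
      finally show ?thesis by simp
    qed
    have 3: "norm (\<Sum>k<n. of_real (\<beta> m k) * (E m k * H k)) \<le> d / 8"
    proof -
      have "norm (E m k * H k) \<le> \<kappa> * (2 * D * d)" if "k < n" for k
      proof -
        have "norm (H k) \<le> \<kappa> * (\<bar>x k\<bar> + \<bar>v k\<bar>)"
          unfolding H_def x_def v_def
          using XV[OF p that] XV[OF q that] \<open>\<delta> > 0\<close> \<open>D * \<delta> = \<rho>\<close> by (intro h_lip \<open>m < n\<close> that) auto
        also have "\<dots> \<le> \<kappa> * (2 * D * d)"
          using x[OF that] v[OF that] \<open>\<kappa> > 0\<close> by (intro mult_left_mono) auto
        finally show ?thesis by (simp add: norm_mult nE)
      qed
      then have "norm (\<Sum>k<n. of_real (\<beta> m k) * (E m k * H k)) \<le> W * (\<kappa> * (2 * D * d))"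
        using \<open>\<kappa> > 0\<close> \<open>D \<ge> 1\<close> \<open>d \<ge> 0\<close> by (intro row_sum \<open>m < n\<close>) auto
      also have "\<dots> = d / 8" using \<open>W \<ge> 1\<close> \<open>D \<ge> 1\<close> by (simp add: \<kappa>_def)
      finally show ?thesis .
    qed
    show ?thesis
      unfolding split using 1 2 3
      by (intro order_trans[OF norm_triangle_ineq4] order_trans[OF add_right_mono[OF norm_triangle_ineq]]) linarith
  qed
  have zero: "X (\<lambda>_. 0) k = 0" "V (\<lambda>_. 0) k = 0" for k
    using X_diff[of "\<lambda>_. 0" "\<lambda>_. 0" k] V_diff[of "\<lambda>_. 0" "\<lambda>_. 0" k] by simp_all
  have start: "norm (G (\<lambda>_. 0) m) \<le> \<delta> / 2" if "m < n" for m
  proof -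
    have "G (\<lambda>_. 0) m = (\<Sum>k<n. of_real (a k * \<beta> m k) * Z m k) - (\<Sum>k<n. of_real (\<beta> m k) * (E m k * of_real (a k)))"
      using base that by (simp add: G_def g_def zero)
    also have "\<dots> = (\<Sum>k<n. of_real (a k * \<beta> m k) * (Z m k - E m k))"
      by (simp add: sum_subtractf[symmetric] algebra_simps)
    also have "norm \<dots> \<le> (\<Sum>k<n. \<bar>a k * \<beta> m k\<bar> * \<epsilon>)"
      by (intro sum_norm_le) (use EZ that in \<open>auto simp: norm_mult abs_mult intro!: mult_left_mono\<close>)
    also have "\<dots> \<le> A * \<epsilon>"
      using rowA[OF that] \<open>\<epsilon> > 0\<close> by (simp add: sum_distrib_right[symmetric] mult_right_mono)
    finally show ?thesis using \<epsilon>2 by simp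
  qed
  have "\<exists>q. (\<forall>m\<in>{..<n}. norm (q m) \<le> \<delta>) \<and> (\<forall>m\<in>{..<n}. G q m = q m)"
  proof (rule coordinatewise_contraction_fixpoint[of \<delta> "{..<n}" G])
    show "\<forall>m\<in>{..<n}. norm (G p m - G q m) \<le> d / 2"
      if "\<forall>m\<in>{..<n}. norm (p m) \<le> \<delta>" "\<forall>m\<in>{..<n}. norm (q m) \<le> \<delta>"
        "\<forall>m\<in>{..<n}. norm (p m - q m) \<le> d" for p q d
      using contract that by blast
  qed (use start \<open>\<delta> > 0\<close> in auto)
  then obtain q where q: "\<forall>m<n. norm (q m) \<le> \<delta>" and fix_q: "\<forall>m<n. G q m = q m" by auto
  have "T k - V q k / a k > 0" if "k < n" for k
  proof -
    have "\<bar>V q k\<bar> < \<bar>a k\<bar>"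
      using XV(2)[OF q that] \<open>\<delta> > 0\<close> \<open>D * \<delta> = \<rho>\<close> \<rho>a[OF that] by simp
    then have "\<bar>V q k / a k\<bar> < 1" by (simp add: field_simps)
    then show ?thesis using T[OF that] by linarith
  qed
  moreover have "(\<Sum>k<n. of_real ((a k + X q k) * \<beta> m k) * exp (- (\<i> * of_real (\<omega> m * (T k - V q k / a k)))))
      = \<i> * of_real (\<omega> m)" if "m < n" for m
  proof -
    have terms: "of_real ((a k + X q k) * \<beta> m k) * exp (- (\<i> * of_real (\<omega> m * (T k - V q k / a k))))
        = of_real (\<beta> m k) * (E m k * g m k (X q k) (V q k))" for k
      by (simp add: E_def g_def exp_add[symmetric] algebra_simps)
    have "G q m = q m" using fix_q that by blast
    then have "(\<Sum>k<n. of_real (\<beta> m k) * (E m k * g m k (X q k) (V q k))) = \<i> * of_real (\<omega> m)"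
      unfolding G_def by simp
    then show ?thesis by (simp only: terms)
  qed
  ultimately have "(\<forall>k<n. T k - V q k / a k > 0) \<and>
    (\<forall>m<n. (\<Sum>k<n. of_real ((a k + X q k) * \<beta> m k) * exp (- (\<i> * of_real (\<omega> m * (T k - V q k / a k)))))
      = \<i> * of_real (\<omega> m))" by blast
  then show ?thesis
    by (intro exI)
qed

section \<open>Amplitudes without zeros\<close>

text \<open>Law of cosines: \<open>c\<close> is the cosine of the angle through which the arm
  \<open>d\<close> is turned for its sum with \<open>R\<close> to have length
  \<open>\<bar>w\<bar>\<close>. Both \<open>R\<close> and \<open>d\<close> may have either
  sign.\<close>

lemma rotate_one_arm:
  fixes R d w :: real
  defines "c \<equiv> (w\<^sup>2 - R\<^sup>2 - d\<^sup>2) / (2 * (R * d))"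
  assumes "R * d \<noteq> 0" "-1 \<le> c" "c \<le> 1"
  shows "norm (Complex c (sqrt (1 - c\<^sup>2))) = 1"
    and "norm (Complex c (sqrt (1 - c\<^sup>2)) - 1) = sqrt (2 - 2 * c)"
    and "norm (of_real R + of_real d * Complex c (sqrt (1 - c\<^sup>2))) = \<bar>w\<bar>"
proof -
  have c2: "c\<^sup>2 \<le> 1" using assms(3,4) by (simp add: abs_square_le_1)
  then show "norm (Complex c (sqrt (1 - c\<^sup>2))) = 1"
    by (simp add: norm_complex_def)
  show "norm (Complex c (sqrt (1 - c\<^sup>2)) - 1) = sqrt (2 - 2 * c)"
    using c2 by (simp add: norm_complex_def power2_eq_square algebra_simps)
  have "w\<^sup>2 = R\<^sup>2 + d\<^sup>2 + 2 * (R * d) * c"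
    using assms(2) by (simp add: c_def)
  moreover have "(R + d * c)\<^sup>2 + (d * sqrt (1 - c\<^sup>2))\<^sup>2 = R\<^sup>2 + d\<^sup>2 + 2 * (R * d) * c"
    using c2 by (simp add: power_mult_distrib power2_sum algebra_simps)
  ultimately have "(R + d * c)\<^sup>2 + (d * sqrt (1 - c\<^sup>2))\<^sup>2 = w\<^sup>2" by simp
  then show "norm (of_real R + of_real d * Complex c (sqrt (1 - c\<^sup>2))) = \<bar>w\<bar>"
    by (simp add: norm_complex_def)
qed

lemma exists_positive_nonroot:
  fixes P :: "nat \<Rightarrow> real poly"
  assumes "\<forall>k<n. P k \<noteq> 0"
  obtains x where "x > 0" "\<forall>k<n. poly (P k) x \<noteq> 0"
proof -
  have "finite (\<Union>k\<in>{..<n}. {x. poly (P k) x = 0})"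
    using assms by (auto intro: poly_roots_finite)
  moreover have "infinite {0::real<..}" by (rule infinite_Ioi)
  ultimately obtain x where "x \<in> {0<..} - (\<Union>k\<in>{..<n}. {x. poly (P k) x = 0})"
    by (metis Diff_infinite_finite finite.emptyI ex_in_conv)
  then show thesis using that by auto
qed

text \<open>The amplitudes a0 are moved in a generic direction, which makes all of them nonzero; the
  direction is such that in each row the sum of the arms moves to the side on which the modulus
  can be restored by slightly rotating one arm. This needs two nonzero amplitudes to start with:
  rotating the only arm of a row does not change the modulus.\<close>

lemma perturb_to_nonzero_amplitudes:
  fixes M N :: "nat \<Rightarrow> nat \<Rightarrow> real" and y :: "nat \<Rightarrow> real" and n :: nat
  defines "a0 \<equiv> \<lambda>k. \<Sum>l<n. N k l * y l"
  assumes MN: "\<And>m u. m < n \<Longrightarrow> (\<Sum>k<n. M m k * (\<Sum>l<n. N k l * u l)) = u m"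
    and N: "\<forall>k<n. \<exists>l<n. N k l \<noteq> 0"
    and M: "\<forall>m<n. \<forall>k<n. M m k \<noteq> 0"
    and y: "\<forall>m<n. y m \<noteq> 0"
    and two: "i < n" "j < n" "i \<noteq> j" "a0 i \<noteq> 0" "a0 j \<noteq> 0"
    and "\<epsilon> > 0"
  shows "\<exists>a (E :: nat \<Rightarrow> nat \<Rightarrow> complex). (\<forall>k<n. a k \<noteq> 0) \<and>
    (\<forall>m<n. \<forall>k<n. norm (E m k) = 1 \<and> norm (E m k - 1) \<le> \<epsilon>) \<and>
    (\<forall>m<n. norm (\<Sum>k<n. of_real (M m k * a k) * E m k) = \<bar>y m\<bar>)"
proof -
  have Ma0: "(\<Sum>k<n. M m k * a0 k) = y m" if "m < n" for m
    unfolding a0_def using MN[OF that] .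
  \<comment> \<open>The arm to be rotated must be nonzero and must not make up the whole row sum. If
    every nonzero arm were equal to \<open>y m\<close>, the row sum would be \<open>y m\<close>
    times their number, so there would be only one.\<close>
  have "\<exists>k<n. a0 k \<noteq> 0 \<and> M m k * a0 k \<noteq> y m" if "m < n" for m
  proof (rule ccontr)
    assume "\<not> ?thesis"
    then have "M m k * a0 k = (if a0 k \<noteq> 0 then y m else 0)" if "k < n" for k
      using that by auto
    then have "(\<Sum>k<n. M m k * a0 k) = (\<Sum>k<n. if a0 k \<noteq> 0 then y m else 0)"
      by (intro sum.cong) auto
    then have "y m = (\<Sum>k<n. if a0 k \<noteq> 0 then y m else 0)"
      unfolding Ma0[OF \<open>m < n\<close>] .
    also have "\<dots> = card {k \<in> {..<n}. a0 k \<noteq> 0} * y m"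
      by (simp add: sum.If_cases Int_def)
    finally have "card {k \<in> {..<n}. a0 k \<noteq> 0} = 1" using y \<open>m < n\<close> by simp
    moreover have "card {i, j} \<le> card {k \<in> {..<n}. a0 k \<noteq> 0}"
      using two by (intro card_mono) auto
    ultimately show False using \<open>i \<noteq> j\<close> by simp
  qed
  then obtain \<mu> where \<mu>: "\<And>m. m < n \<Longrightarrow> \<mu> m < n" "\<And>m. m < n \<Longrightarrow> a0 (\<mu> m) \<noteq> 0"
    "\<And>m. m < n \<Longrightarrow> M m (\<mu> m) * a0 (\<mu> m) \<noteq> y m" by metis
  define d0 where "d0 m = M m (\<mu> m) * a0 (\<mu> m)" for m
  \<comment> \<open>Positive if the arm and the rest of the row point the same way: turning the arm
    shortens the sum, so the sum must be lengthened beforehand. Negative in the opposite case, where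
    turning lengthens it.\<close>
  define s where "s m = sgn ((y m - d0 m) * d0 m)" for m
  have Rd0: "(y m - d0 m) * d0 m \<noteq> 0" if "m < n" for m
    using \<mu>[OF that] M that by (simp add: d0_def)
  then have s: "s m * s m = 1" if "m < n" for m using that by (simp add: s_def sgn_if)
  \<comment> \<open>The direction \<open>b\<close> below is chosen so that \<open>M\<close> maps it
    to the row changes \<open>y l * s l * x ^ l\<close>. Its entry \<open>k\<close> is a polynomial
    in \<open>x\<close>, not zero because row \<open>k\<close> of \<open>N\<close> is not zero. A
    positive \<open>x\<close> avoiding finitely many roots preserves the signs \<open>s\<close> and
    makes every entry of \<open>b\<close> nonzero.\<close>
  define P where "P k = (\<Sum>l<n. monom (N k l * (y l * s l)) l)" for k
  have "P k \<noteq> 0" if k: "k < n" for k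
  proof -
    obtain l where l: "l < n" "N k l \<noteq> 0" using N k by blast
    then have "coeff (P k) l = N k l * (y l * s l)"
      by (simp add: P_def coeff_sum)
    also have "\<dots> \<noteq> 0" using l y s[OF l(1)] by auto
    finally show ?thesis by auto
  qed
  then obtain x where "x > 0" and x: "\<forall>k<n. poly (P k) x \<noteq> 0"
    using exists_positive_nonroot[of n P] by blast
  define b where "b k = (\<Sum>l<n. N k l * (y l * s l * x ^ l))" for k
  have b: "b k \<noteq> 0" if "k < n" for k
    using x that by (simp add: P_def b_def poly_sum poly_monom mult.assoc)
  define a where "a t k = a0 k + t * b k" for t k
  have Ma: "(\<Sum>k<n. M m k * a t k) = y m * (1 + t * (s m * x ^ m))" if "m < n" for m t
  proof -
    have "(\<Sum>k<n. M m k * b k) = y m * s m * x ^ m"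
      unfolding b_def using MN[OF that] .
    moreover have "(\<Sum>k<n. M m k * a t k) = (\<Sum>k<n. M m k * a0 k) + t * (\<Sum>k<n. M m k * b k)"
      by (simp add: a_def sum_distrib_left sum.distrib[symmetric] algebra_simps)
    ultimately show ?thesis using Ma0[OF that] by (simp add: algebra_simps)
  qed
  define d where "d t m = M m (\<mu> m) * a t (\<mu> m)" for t m
  define R where "R t m = y m * (1 + t * (s m * x ^ m)) - d t m" for t m
  define c where "c t m = ((y m)\<^sup>2 - (R t m)\<^sup>2 - (d t m)\<^sup>2) / (2 * (R t m * d t m))" for t m
  have lim_a: "((\<lambda>t. a t k) \<longlongrightarrow> a0 k) (at_right 0)" for k
    unfolding a_def by (auto intro!: tendsto_eq_intros)
  have lim_d: "((\<lambda>t. d t m) \<longlongrightarrow> d0 m) (at_right 0)" for m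
    unfolding d_def d0_def by (intro tendsto_intros lim_a)
  have lim_R: "((\<lambda>t. R t m) \<longlongrightarrow> y m - d0 m) (at_right 0)" for m
    unfolding R_def by (auto intro!: tendsto_eq_intros lim_d)
  have lim_c: "((\<lambda>t. c t m) \<longlongrightarrow> 1) (at_right 0)" if "m < n" for m
  proof -
    have "((\<lambda>t. c t m) \<longlongrightarrow> ((y m)\<^sup>2 - (y m - d0 m)\<^sup>2 - (d0 m)\<^sup>2) / (2 * ((y m - d0 m) * d0 m))) (at_right 0)"
      unfolding c_def using Rd0[OF that] by (intro tendsto_intros lim_d lim_R) simp
    moreover have "(y m)\<^sup>2 - (y m - d0 m)\<^sup>2 - (d0 m)\<^sup>2 = 2 * ((y m - d0 m) * d0 m)"
      by (simp add: power2_eq_square algebra_simps)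
    ultimately show ?thesis using Rd0[OF that] by simp
  qed
  have ev_pos: "\<forall>\<^sub>F t in at_right (0::real). t > 0" by (simp add: eventually_at_right_less)
  have ev_a: "\<forall>\<^sub>F t in at_right 0. a t k \<noteq> 0" if "k < n" for k
  proof (cases "a0 k = 0")
    case True
    show ?thesis
      using ev_pos by eventually_elim (use True b[OF that] in \<open>simp add: a_def\<close>)
  next
    case False
    then show ?thesis by (rule tendsto_imp_eventually_ne[OF lim_a])
  qed
  have ev_c: "\<forall>\<^sub>F t in at_right 0. R t m * d t m \<noteq> 0 \<and> -1 \<le> c t m \<and> c t m \<le> 1 \<and> sqrt (2 - 2 * c t m) \<le> \<epsilon>"
    if "m < n" for m
  proof -
    have "((\<lambda>t. s m * (R t m * d t m)) \<longlongrightarrow> s m * ((y m - d0 m) * d0 m)) (at_right 0)"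
      by (intro tendsto_intros lim_R lim_d)
    moreover have "s m * ((y m - d0 m) * d0 m) > 0"
      using Rd0[OF that] unfolding s_def by (metis abs_sgn mult.commute zero_less_abs_iff)
    ultimately have 1: "\<forall>\<^sub>F t in at_right 0. s m * (R t m * d t m) > 0"
      by (rule order_tendstoD)
    \<comment> \<open>The threshold is the condition
      \<open>sqrt (2 - 2 * c t m) \<le> \<epsilon>\<close> solved for the cosine.\<close>
    have 2: "\<forall>\<^sub>F t in at_right 0. c t m > max (-1) (1 - \<epsilon>\<^sup>2 / 2)"
      using \<open>\<epsilon> > 0\<close> by (intro order_tendstoD[OF lim_c[OF that]]) auto
    have "((\<lambda>t. 2 + t * (s m * x ^ m)) \<longlongrightarrow> 2 + 0 * (s m * x ^ m)) (at_right 0)"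
      by (intro tendsto_intros)
    then have 3: "\<forall>\<^sub>F t in at_right 0. 2 + t * (s m * x ^ m) > 0"
      by (rule order_tendstoD) simp
    from 1 2 3 ev_pos show ?thesis
    proof eventually_elim
      case (elim t)
      define A where "A = R t m * d t m"
      have "A \<noteq> 0" using elim(1) by (auto simp: A_def)
      \<comment> \<open>Here the choice of \<open>s\<close> pays off: the numerator has the sign of
        \<open>- s m\<close> and the denominator that of \<open>s m\<close>, so the required cosine
        does not exceed 1.\<close>
      have "c t m - 1 = ((y m)\<^sup>2 - (R t m + d t m)\<^sup>2) / (2 * A)"
        using \<open>A \<noteq> 0\<close> by (simp add: c_def A_def[symmetric] field_simps power2_sum)
      also have "R t m + d t m = y m * (1 + t * (s m * x ^ m))" by (simp add: R_def)
      also have "(y m)\<^sup>2 - (y m * (1 + t * (s m * x ^ m)))\<^sup>2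
          = - ((y m)\<^sup>2 * t * x ^ m * (2 + t * (s m * x ^ m))) * s m"
        by (simp add: power2_eq_square algebra_simps)
      also have "\<dots> / (2 * A) = - ((y m)\<^sup>2 * t * x ^ m * (2 + t * (s m * x ^ m))) * (1 / (2 * (s m * A)))"
      proof -
        have "s m / A = 1 / (s m * A)" using s[OF that] \<open>A \<noteq> 0\<close>
          by (cases "s m = 0") (auto simp: field_simps)
        then have "u * s m / (2 * A) = u * (1 / (2 * (s m * A)))" for u
          using times_divide_times_eq[of u 2 "s m" A] by simp
        then show ?thesis .
      qed
      also have "\<dots> \<le> 0"
        using elim \<open>x > 0\<close> by (intro mult_nonpos_nonneg) (auto simp: A_def)
      finally have "c t m \<le> 1" by simp
      moreover have "sqrt (2 - 2 * c t m) \<le> \<epsilon>"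
        using elim(2) \<open>\<epsilon> > 0\<close> by (intro real_le_lsqrt) auto
      ultimately show ?case using elim(2) \<open>A \<noteq> 0\<close> by (simp add: A_def)
    qed
  qed
  have ev1: "\<forall>\<^sub>F t in at_right 0. \<forall>k\<in>{..<n}. a t k \<noteq> 0"
    by (intro eventually_ball_finite finite_lessThan ballI ev_a) simp
  have ev2: "\<forall>\<^sub>F t in at_right 0. \<forall>m\<in>{..<n}.
      R t m * d t m \<noteq> 0 \<and> -1 \<le> c t m \<and> c t m \<le> 1 \<and> sqrt (2 - 2 * c t m) \<le> \<epsilon>"
    by (intro eventually_ball_finite finite_lessThan ballI ev_c) simp
  obtain t where t: "\<And>k. k < n \<Longrightarrow> a t k \<noteq> 0"
    and ct: "\<And>m. m < n \<Longrightarrow> R t m * d t m \<noteq> 0 \<and> -1 \<le> c t m \<and> c t m \<le> 1 \<and> sqrt (2 - 2 * c t m) \<le> \<epsilon>"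
    using eventually_happens'[OF _ eventually_conj[OF ev1 ev2]] by auto
  define E where "E m k = (if k = \<mu> m then Complex (c t m) (sqrt (1 - (c t m)\<^sup>2)) else 1)" for m k
  have "norm (E m k) = 1 \<and> norm (E m k - 1) \<le> \<epsilon>" if "m < n" for m k
    using rotate_one_arm(1,2)[of "R t m" "d t m" "y m"] ct[OF that] \<open>\<epsilon> > 0\<close> by (simp add: E_def c_def)
  moreover have "norm (\<Sum>k<n. of_real (M m k * a t k) * E m k) = \<bar>y m\<bar>" if "m < n" for m
  proof -
    have "(\<Sum>k<n. of_real (M m k * a t k) * E m k)
        = of_real (d t m) * E m (\<mu> m) + (\<Sum>k\<in>{..<n} - {\<mu> m}. of_real (M m k * a t k) * E m k)"
      using \<mu>(1)[OF that] by (subst sum.remove[of _ "\<mu> m"]) (auto simp: d_def)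
    also have "(\<Sum>k\<in>{..<n} - {\<mu> m}. of_real (M m k * a t k) * E m k)
        = of_real (\<Sum>k\<in>{..<n} - {\<mu> m}. M m k * a t k)"
      unfolding of_real_sum by (intro sum.cong) (auto simp: E_def)
    also have "(\<Sum>k\<in>{..<n} - {\<mu> m}. M m k * a t k) = R t m"
      using \<mu>(1)[OF that] Ma[OF that, of t]
      by (subst (asm) sum.remove[of _ "\<mu> m"]) (auto simp: d_def R_def)
    finally show ?thesis
      using rotate_one_arm(3)[of "R t m" "d t m" "y m"] ct[OF that] by (simp add: E_def c_def add.commute)
  qed
  ultimately have "(\<forall>k<n. a t k \<noteq> 0) \<and> (\<forall>m<n. \<forall>k<n. norm (E m k) = 1 \<and> norm (E m k - 1) \<le> \<epsilon>) \<and>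
    (\<forall>m<n. norm (\<Sum>k<n. of_real (M m k * a t k) * E m k) = \<bar>y m\<bar>)"
    using t by blast
  then show ?thesis by (intro exI)
qed

text \<open>Call \<open>y\<close> a sign vector if its entries have the moduli
  \<open>\<omega> m\<close>. If every sign vector had a single nonzero amplitude, each would be a
  multiple of one column of \<open>M\<close>, and a column can serve only one sign vector and its
  negative. For \<open>n \<ge> 3\<close> the vectors \<open>\<omega>\<close>, \<open>y1\<close>,
  \<open>y2\<close> then use three columns, so \<open>y1 + y2 - \<omega>\<close>, again a sign
  vector, has two nonzero amplitudes. For \<open>n = 2\<close> the argument stops, because
  \<open>y2 = - y1\<close>.\<close>

lemma two_nonzero_amplitudes_or_degenerate:
  fixes M N :: "nat \<Rightarrow> nat \<Rightarrow> real" and \<omega> :: "nat \<Rightarrow> real"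
  assumes MN: "\<And>m u. m < n \<Longrightarrow> (\<Sum>k<n. M m k * (\<Sum>l<n. N k l * u l)) = u m"
    and M: "\<forall>m<n. \<forall>k<n. M m k \<noteq> 0"
    and \<omega>: "\<forall>m<n. \<omega> m > 0" and "n \<ge> 2"
  obtains (two) y i j where "\<forall>m<n. \<bar>y m\<bar> = \<omega> m" "i < n" "j < n" "i \<noteq> j"
      "(\<Sum>l<n. N i l * y l) \<noteq> 0" "(\<Sum>l<n. N j l * y l) \<noteq> 0"
  | (degenerate) k0 k1 c0 c1 where "n = 2" "k0 < 2" "k1 < 2" "k0 \<noteq> k1"
      "M 0 k0 * c0 = \<omega> 0" "M 1 k0 * c0 = \<omega> 1" "M 0 k1 * c1 = - \<omega> 0" "M 1 k1 * c1 = \<omega> 1"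
proof (cases "\<exists>y i j. (\<forall>m<n. \<bar>y m\<bar> = \<omega> m) \<and> i < n \<and> j < n \<and> i \<noteq> j \<and>
      (\<Sum>l<n. N i l * y l) \<noteq> 0 \<and> (\<Sum>l<n. N j l * y l) \<noteq> 0")
  case True
  then show thesis using two by blast
next
  case False
  define a where "a y k = (\<Sum>l<n. N k l * y l)" for y k
  have single: "\<exists>k<n. a y k \<noteq> 0 \<and> (\<forall>j<n. j \<noteq> k \<longrightarrow> a y j = 0) \<and> (\<forall>m<n. M m k * a y k = y m)"
    if y: "\<forall>m<n. \<bar>y m\<bar> = \<omega> m" for y
  proof -
    have My: "(\<Sum>k<n. M m k * a y k) = y m" if "m < n" for m
      unfolding a_def using MN[OF that] .
    have "y 0 \<noteq> 0" using y \<omega> \<open>n \<ge> 2\<close> by fastforce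
    have "\<exists>k<n. a y k \<noteq> 0"
    proof (rule ccontr)
      assume "\<not> ?thesis"
      then have "(\<Sum>k<n. M 0 k * a y k) = 0" by simp
      with My[of 0] \<open>n \<ge> 2\<close> \<open>y 0 \<noteq> 0\<close> show False by simp
    qed
    then obtain k where k: "k < n" "a y k \<noteq> 0" by blast
    have 0: "a y j = 0" if "j < n" "j \<noteq> k" for j
      using False y k that unfolding a_def by blast
    have "M m k * a y k = y m" if "m < n" for m
    proof -
      have "(\<Sum>j<n. M m j * a y j) = (\<Sum>j\<in>{k}. M m j * a y j)"
        using k 0 by (intro sum.mono_neutral_right) auto
      then show ?thesis using My[OF that] by simp
    qed
    with k 0 show ?thesis by blast
  qed
  define y1 where "y1 m = (if m = 0 then - \<omega> m else \<omega> m)" for m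
  define y2 where "y2 m = (if m = 1 then - \<omega> m else \<omega> m)" for m
  have y: "\<forall>m<n. \<bar>\<omega> m\<bar> = \<omega> m" using \<omega> by (auto simp: abs_of_pos)
  then have y1: "\<forall>m<n. \<bar>y1 m\<bar> = \<omega> m" and y2: "\<forall>m<n. \<bar>y2 m\<bar> = \<omega> m"
    by (auto simp: y1_def y2_def)
  obtain k0 where k0: "k0 < n" "a \<omega> k0 \<noteq> 0" "\<And>j. \<lbrakk>j < n; j \<noteq> k0\<rbrakk> \<Longrightarrow> a \<omega> j = 0"
    and c0: "\<And>m. m < n \<Longrightarrow> M m k0 * a \<omega> k0 = \<omega> m"
    using single[OF y] by blast
  obtain k1 where k1: "k1 < n" "a y1 k1 \<noteq> 0" "\<And>j. \<lbrakk>j < n; j \<noteq> k1\<rbrakk> \<Longrightarrow> a y1 j = 0"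
    and c1: "\<And>m. m < n \<Longrightarrow> M m k1 * a y1 k1 = y1 m"
    using single[OF y1] by blast
  obtain k2 where k2: "k2 < n" "a y2 k2 \<noteq> 0" "\<And>j. \<lbrakk>j < n; j \<noteq> k2\<rbrakk> \<Longrightarrow> a y2 j = 0"
    and c2: "\<And>m. m < n \<Longrightarrow> M m k2 * a y2 k2 = y2 m"
    using single[OF y2] by blast
  have clash: False
    if "k < n" "m < n" "m' < n" "M m k * p = u" "M m k * q = u" "M m' k * p = v" "M m' k * q = - v" "v \<noteq> 0"
    for k m m' p q u v
  proof -
    have "p = q" using that M by (metis mult_cancel_left)
    then show False using that by simp
  qed
  have "\<omega> 0 \<noteq> 0" "\<omega> 1 \<noteq> 0"
    using \<omega>[rule_format, of 0] \<omega>[rule_format, of 1] \<open>n \<ge> 2\<close> by simp_all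
  have "k0 \<noteq> k1"
    using clash[of k0 1 0 "a \<omega> k0" "\<omega> 1" "a y1 k1" "\<omega> 0"] c0[of 0] c0[of 1] c1[of 0] c1[of 1] \<open>n \<ge> 2\<close> k0(1) \<open>\<omega> 0 \<noteq> 0\<close>
    by (auto simp: y1_def)
  show thesis
  proof (cases "n = 2")
    case True
    show thesis
      by (rule degenerate[of k0 k1 "a \<omega> k0" "a y1 k1"])
        (use True k0 k1 c0[of 0] c0[of 1] c1[of 0] c1[of 1] \<open>k0 \<noteq> k1\<close> in \<open>auto simp: y1_def\<close>)
  next
    case False
    with \<open>n \<ge> 2\<close> have "n > 2" by simp
    then have "\<omega> 2 \<noteq> 0" using \<omega>[rule_format, of 2] by simp
    have "k0 \<noteq> k2"
      using clash[of k0 0 1 "a \<omega> k0" "\<omega> 0" "a y2 k2" "\<omega> 1"] c0[of 0] c0[of 1] c2[of 0] c2[of 1] \<open>n \<ge> 2\<close> k0(1) \<open>\<omega> 1 \<noteq> 0\<close>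
      by (auto simp: y2_def)
    \<comment> \<open>Row 2 is where \<open>y1\<close> and \<open>y2\<close> agree while differing
      in row 1; this is where \<open>n > 2\<close> enters.\<close>
    have "k1 \<noteq> k2"
      using clash[of k1 2 1 "a y1 k1" "\<omega> 2" "a y2 k2" "\<omega> 1"] c1[of 2] c1[of 1] c2[of 2] c2[of 1] \<open>n > 2\<close> k1(1) \<open>\<omega> 1 \<noteq> 0\<close>
      by (auto simp: y1_def y2_def)
    define y3 where "y3 m = y1 m + y2 m - \<omega> m" for m
    have y3: "\<forall>m<n. \<bar>y3 m\<bar> = \<omega> m"
      using y by (auto simp: y1_def y2_def y3_def)
    have a3: "a y3 k = a y1 k + a y2 k - a \<omega> k" for k
      by (simp add: a_def y3_def algebra_simps sum.distrib sum_subtractf)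
    have "a y3 k1 \<noteq> 0" "a y3 k2 \<noteq> 0"
      using k0 k1 k2 \<open>k0 \<noteq> k1\<close> \<open>k0 \<noteq> k2\<close> \<open>k1 \<noteq> k2\<close> by (simp_all add: a3)
    then show thesis
      using two[of y3 k1 k2] y3 k1(1) k2(1) \<open>k1 \<noteq> k2\<close> by (simp add: a_def)
  qed
qed

section \<open>Solvability of the flattened system\<close>

text \<open>The pairs \<open>(j, l)\<close> are flattened into one 0-based row index
  \<open>m\<close>: the division into blocks disappears, and each row has its own coefficients and
  frequency.\<close>

definition delay_solvable :: "nat \<Rightarrow> (nat \<Rightarrow> nat \<Rightarrow> real) \<Rightarrow> (nat \<Rightarrow> real) \<Rightarrow> bool" where
  "delay_solvable n \<beta> \<omega> \<longleftrightarrow> (\<exists>\<tau> c. (\<forall>k<n. \<tau> k > 0) \<and>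
    (\<forall>m<n. (\<Sum>k<n. of_real (c k * \<beta> m k) * exp (- (\<i> * of_real (\<omega> m * \<tau> k)))) = \<i> * of_real (\<omega> m)))"

text \<open>Only the modulus of each row sum matters: Kronecker's theorem can realise any common phase
  of a row, and a phase factor does not affect the invertibility of the linearisation.\<close>

lemma delay_solvable_near_sign_pattern:
  fixes \<beta> M N :: "nat \<Rightarrow> nat \<Rightarrow> real" and \<omega> :: "nat \<Rightarrow> real"
  assumes indep: "rat_independent_family \<omega> {..<n}"
    and \<omega>: "\<forall>m<n. \<omega> m > 0"
    and \<beta>: "\<forall>m<n. \<forall>k<n. \<beta> m k \<noteq> 0"
    and M: "\<forall>m<n. \<forall>k<n. \<bar>M m k\<bar> = \<bar>\<beta> m k\<bar>"
    and MN: "\<And>m u. m < n \<Longrightarrow> (\<Sum>k<n. M m k * (\<Sum>l<n. N k l * u l)) = u m"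
  obtains \<epsilon> where "\<epsilon> > 0"
    "\<And>a (E :: nat \<Rightarrow> nat \<Rightarrow> complex). \<lbrakk>\<forall>k<n. a k \<noteq> 0; \<forall>m<n. \<forall>k<n. norm (E m k) = 1 \<and> norm (E m k - 1) \<le> \<epsilon>;
       \<forall>m<n. norm (\<Sum>k<n. of_real (M m k * a k) * E m k) = \<omega> m\<rbrakk> \<Longrightarrow> delay_solvable n \<beta> \<omega>"
proof -
  define C where "C = 1 + (\<Sum>k<n. \<Sum>l<n. \<bar>N k l\<bar> * (1 + 1 / \<omega> l))"
  define W where "W = 1 + (\<Sum>m<n. \<Sum>k<n. \<bar>M m k\<bar>)"
  define \<Omega> where "\<Omega> = (\<Sum>m<n. \<bar>\<omega> m\<bar>)"
  have N_nonneg: "\<bar>N k l\<bar> * (1 + 1 / \<omega> l) \<ge> 0" if "l < n" for k l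
    using \<omega> that by (simp add: less_imp_le)
  have rowC_nonneg: "(\<Sum>l<n. \<bar>N k l\<bar> * (1 + 1 / \<omega> l)) \<ge> 0" for k
    by (intro sum_nonneg N_nonneg) simp
  then have "C \<ge> 1" "W \<ge> 1" "\<Omega> \<ge> 0"
    by (simp_all add: C_def W_def \<Omega>_def sum_nonneg)
  have rowC: "(\<Sum>l<n. \<bar>N k l\<bar> * (1 + 1 / \<omega> l)) \<le> C" if "k < n" for k
    using member_le_sum[of k "{..<n}" "\<lambda>k. \<Sum>l<n. \<bar>N k l\<bar> * (1 + 1 / \<omega> l)"] that rowC_nonneg
    by (simp add: C_def)
  have rowW: "(\<Sum>k<n. \<bar>M m k\<bar>) \<le> W" if "m < n" for m
    using member_le_sum[of m "{..<n}" "\<lambda>m. \<Sum>k<n. \<bar>M m k\<bar>"] that by (simp add: W_def sum_nonneg)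
  have \<Omega>: "\<bar>\<omega> m\<bar> \<le> \<Omega>" if "m < n" for m
    using member_le_sum[of m "{..<n}" "\<lambda>m. \<bar>\<omega> m\<bar>"] that by (simp add: \<Omega>_def)
  \<comment> \<open>Tuned to the tolerance \<open>d / 4\<close> of
    \<open>delay_system_solvable\<close>; \<open>C * (1 + \<Omega>) * d\<close> bounds the
    increments \<open>x + \<i> * \<omega> m * v\<close>.\<close>
  define \<epsilon> where "\<epsilon> = 1 / (4 * (W * (C * (1 + \<Omega>))))"
  have WC: "W * (C * (1 + \<Omega>)) > 0" using \<open>C \<ge> 1\<close> \<open>W \<ge> 1\<close> \<open>\<Omega> \<ge> 0\<close> by simp
  have "1 / (4 * z) * z = 1 / 4" if "z > 0" for z :: real using that by simp
  from this[OF WC] have \<epsilon>_WC: "\<epsilon> * (W * (C * (1 + \<Omega>))) = 1 / 4" unfolding \<epsilon>_def .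
  have "\<epsilon> > 0" using WC by (simp add: \<epsilon>_def)
  moreover have "delay_solvable n \<beta> \<omega>"
    if a: "\<forall>k<n. a k \<noteq> 0" and E: "\<forall>m<n. \<forall>k<n. norm (E m k) = 1 \<and> norm (E m k - 1) \<le> \<epsilon>"
      and row: "\<forall>m<n. norm (\<Sum>k<n. of_real (M m k * a k) * E m k) = \<omega> m"
    for a :: "nat \<Rightarrow> real" and E :: "nat \<Rightarrow> nat \<Rightarrow> complex"
  proof -
    define S where "S m = (\<Sum>k<n. of_real (M m k * a k) * E m k)" for m
    \<comment> \<open>The unit number carrying the row sum \<open>S m\<close>, prescribed only in
      modulus, to the required \<open>\<i> * \<omega> m\<close>.\<close>
    define \<rho> where "\<rho> m = \<i> * of_real (\<omega> m) / S m" for m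
    \<comment> \<open>The quotient \<open>M m k / \<beta> m k\<close> is 1 or -1: a sign of the
      pattern is realised as a phase.\<close>
    define Z where "Z m k = \<rho> m * of_real (M m k / \<beta> m k) * E m k" for m k
    \<comment> \<open>Inverse of the linearisation at \<open>E = 1\<close>: after division by
      \<open>\<rho>\<close>, \<open>X\<close> solves for the real parts and \<open>V\<close> for the
      imaginary parts, which carry the factor \<open>\<omega> l\<close>.\<close>
    define X where "X q k = (\<Sum>l<n. N k l * Re (q l / \<rho> l))" for q k
    define V where "V q k = (\<Sum>l<n. N k l * (Im (q l / \<rho> l) / \<omega> l))" for q k
    have S: "norm (S m) = \<omega> m" "S m \<noteq> 0" if "m < n" for m
    proof -
      show "norm (S m) = \<omega> m" using row that by (simp only: S_def)
      then show "S m \<noteq> 0" using \<omega> that by force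
    qed
    have \<rho>: "norm (\<rho> m) = 1" if "m < n" for m
      using S[OF that] \<omega>[rule_format, OF that] by (simp add: \<rho>_def norm_mult norm_divide)
    have \<beta>Z: "of_real (\<beta> m k) * Z m k = \<rho> m * (of_real (M m k) * E m k)" if "m < n" "k < n" for m k
      using \<beta> that by (simp add: Z_def)
    have MX: "(\<Sum>k<n. M m k * X q k) = Re (q m / \<rho> m)"
      and MV: "(\<Sum>k<n. M m k * V q k) = Im (q m / \<rho> m) / \<omega> m" if "m < n" for q m
      unfolding X_def V_def by (rule MN[OF that])+
    have XV: "\<bar>X q k\<bar> \<le> C * d \<and> \<bar>V q k\<bar> \<le> C * d" if q: "\<forall>m<n. norm (q m) \<le> d" and "k < n" for q d k
    proof -
      have "d \<ge> 0" using q \<open>k < n\<close> norm_ge_zero order_trans by blast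
      have w: "norm (q l / \<rho> l) \<le> d" if "l < n" for l
        using q \<rho> that by (simp add: norm_divide)
      have "\<bar>X q k\<bar> \<le> (\<Sum>l<n. \<bar>N k l\<bar> * (1 + 1 / \<omega> l) * d)"
        unfolding X_def
      proof (rule order_trans[OF sum_abs], rule sum_mono)
        fix l assume "l \<in> {..<n}"
        then have "l < n" by simp
        have "\<bar>Re (q l / \<rho> l)\<bar> \<le> 1 * d" using w[OF \<open>l < n\<close>] abs_Re_le_cmod order_trans by fastforce
        also have "\<dots> \<le> (1 + 1 / \<omega> l) * d" using \<omega> \<open>l < n\<close> \<open>d \<ge> 0\<close> by (intro mult_right_mono) (auto simp: less_imp_le)
        finally show "\<bar>N k l * Re (q l / \<rho> l)\<bar> \<le> \<bar>N k l\<bar> * (1 + 1 / \<omega> l) * d"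
          by (simp only: abs_mult mult.assoc mult_left_mono abs_ge_zero)
      qed
      moreover have "\<bar>V q k\<bar> \<le> (\<Sum>l<n. \<bar>N k l\<bar> * (1 + 1 / \<omega> l) * d)"
        unfolding V_def
      proof (rule order_trans[OF sum_abs], rule sum_mono)
        fix l assume "l \<in> {..<n}"
        then have "l < n" by simp
        have "\<bar>Im (q l / \<rho> l)\<bar> \<le> d" using w[OF \<open>l < n\<close>] abs_Im_le_cmod order_trans by blast
        then have "\<bar>Im (q l / \<rho> l) / \<omega> l\<bar> \<le> 1 / \<omega> l * d"
          using \<omega>[rule_format, OF \<open>l < n\<close>] by (simp add: divide_right_mono)
        also have "\<dots> \<le> (1 + 1 / \<omega> l) * d" using \<open>d \<ge> 0\<close> by (intro mult_right_mono) auto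
        finally show "\<bar>N k l * (Im (q l / \<rho> l) / \<omega> l)\<bar> \<le> \<bar>N k l\<bar> * (1 + 1 / \<omega> l) * d"
          by (simp only: abs_mult[of "N k l"] mult.assoc mult_left_mono abs_ge_zero)
      qed
      moreover have "(\<Sum>l<n. \<bar>N k l\<bar> * (1 + 1 / \<omega> l) * d) \<le> C * d"
        unfolding sum_distrib_right[symmetric] by (intro mult_right_mono rowC \<open>k < n\<close> \<open>d \<ge> 0\<close>)
      ultimately show ?thesis by linarith
    qed
    show ?thesis
      unfolding delay_solvable_def
    proof (rule delay_system_solvable[of \<omega> n Z a \<beta> X V C])
      show "\<forall>m<n. \<forall>k<n. norm (Z m k) = 1"
        using \<rho> E M \<beta> by (simp add: Z_def norm_mult norm_divide)
      show "\<forall>m<n. (\<Sum>k<n. of_real (a k * \<beta> m k) * Z m k) = \<i> * of_real (\<omega> m)"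
      proof (intro allI impI)
        fix m assume "m < n"
        have "(\<Sum>k<n. of_real (a k * \<beta> m k) * Z m k) = (\<Sum>k<n. \<rho> m * (of_real (M m k * a k) * E m k))"
          using \<beta>Z[OF \<open>m < n\<close>] by (intro sum.cong) (auto simp: mult.assoc mult.left_commute)
        also have "\<dots> = \<rho> m * S m" by (simp only: sum_distrib_left S_def)
        also have "\<dots> = \<i> * of_real (\<omega> m)" using S(2)[OF \<open>m < n\<close>] by (simp add: \<rho>_def)
        finally show "(\<Sum>k<n. of_real (a k * \<beta> m k) * Z m k) = \<i> * of_real (\<omega> m)" .
      qed
      show "X (\<lambda>m. p m - q m) k = X p k - X q k" "V (\<lambda>m. p m - q m) k = V p k - V q k" for p q k
        by (simp_all add: X_def V_def diff_divide_distrib right_diff_distrib sum_subtractf)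
      show "\<bar>X q k\<bar> \<le> C * d \<and> \<bar>V q k\<bar> \<le> C * d" if "\<forall>m<n. norm (q m) \<le> d" "k < n" for q d k
        using XV that .
      show "norm (q m - (\<Sum>k<n. of_real (\<beta> m k) * Z m k * (of_real (X q k) + \<i> * of_real (\<omega> m * V q k)))) \<le> d / 4"
        if q: "\<forall>m<n. norm (q m) \<le> d" and "m < n" for q d m
      proof -
        have "d \<ge> 0" using q \<open>m < n\<close> norm_ge_zero order_trans by blast
        define L where "L k = complex_of_real (X q k) + \<i> * of_real (\<omega> m * V q k)" for k
        have "norm (L k) \<le> C * (1 + \<Omega>) * d" if "k < n" for k
        proof -
          have "norm (L k) \<le> \<bar>X q k\<bar> + \<bar>\<omega> m\<bar> * \<bar>V q k\<bar>"
            unfolding L_def by (rule order_trans[OF norm_triangle_ineq]) (simp add: norm_mult abs_mult)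
          also have "\<dots> \<le> C * d + \<Omega> * (C * d)"
            using XV[OF q that] \<Omega> \<open>\<Omega> \<ge> 0\<close> \<open>m < n\<close> by (intro add_mono mult_mono) auto
          finally show ?thesis by (simp add: algebra_simps)
        qed
        note L = this
        have "(\<Sum>k<n. of_real (M m k) * L k) = of_real (\<Sum>k<n. M m k * X q k) + \<i> * of_real (\<omega> m) * of_real (\<Sum>k<n. M m k * V q k)"
          by (simp add: L_def algebra_simps sum.distrib sum_distrib_left)
        also have "\<dots> = q m / \<rho> m"
          using \<omega>[rule_format, OF \<open>m < n\<close>] \<open>m < n\<close> by (simp add: MX MV complex_eq_iff)
        finally have "\<rho> m * (\<Sum>k<n. of_real (M m k) * L k) = q m" using \<rho>[OF \<open>m < n\<close>] by auto
        moreover have "(\<Sum>k<n. of_real (\<beta> m k) * Z m k * L k) = \<rho> m * (\<Sum>k<n. of_real (M m k) * E m k * L k)"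
          unfolding sum_distrib_left using \<beta>Z[OF \<open>m < n\<close>] by (intro sum.cong) auto
        \<comment> \<open>For \<open>E = 1\<close> the inverse is exact, so the whole error carries
          the factors \<open>1 - E m k\<close>.\<close>
        ultimately have "q m - (\<Sum>k<n. of_real (\<beta> m k) * Z m k * L k)
            = \<rho> m * (\<Sum>k<n. of_real (M m k) * L k - of_real (M m k) * E m k * L k)"
          by (simp only: sum_subtractf right_diff_distrib)
        then have "norm (q m - (\<Sum>k<n. of_real (\<beta> m k) * Z m k * L k))
            = norm (\<Sum>k<n. of_real (M m k) * L k - of_real (M m k) * E m k * L k)"
          using \<rho>[OF \<open>m < n\<close>] by (simp only: norm_mult mult_1_left)
        also have "\<dots> \<le> (\<Sum>k<n. \<bar>M m k\<bar> * (\<epsilon> * (C * (1 + \<Omega>) * d)))"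
        proof (rule sum_norm_le)
          fix k assume "k \<in> {..<n}"
          then have "k < n" by simp
          have "of_real (M m k) * L k - of_real (M m k) * E m k * L k = of_real (M m k) * ((1 - E m k) * L k)"
            by (simp add: algebra_simps)
          also have "norm \<dots> = \<bar>M m k\<bar> * (norm (E m k - 1) * norm (L k))"
            by (simp add: norm_mult norm_minus_commute)
          also have "\<dots> \<le> \<bar>M m k\<bar> * (\<epsilon> * (C * (1 + \<Omega>) * d))"
            using E L[OF \<open>k < n\<close>] \<open>m < n\<close> \<open>k < n\<close> \<open>\<epsilon> > 0\<close> by (intro mult_left_mono mult_mono) auto
          finally show "norm (of_real (M m k) * L k - of_real (M m k) * E m k * L k) \<le> \<bar>M m k\<bar> * (\<epsilon> * (C * (1 + \<Omega>) * d))" .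
        qed
        also have "\<dots> \<le> W * (\<epsilon> * (C * (1 + \<Omega>) * d))"
          unfolding sum_distrib_right[symmetric]
          using rowW[OF \<open>m < n\<close>] \<open>\<epsilon> > 0\<close> \<open>C \<ge> 1\<close> \<open>\<Omega> \<ge> 0\<close> \<open>d \<ge> 0\<close> by (intro mult_right_mono) auto
        also have "\<dots> = \<epsilon> * (W * (C * (1 + \<Omega>))) * d" by simp
        also have "\<dots> = d / 4" by (simp only: \<epsilon>_WC)
        finally show ?thesis unfolding L_def .
      qed
    qed (use indep a in auto)
  qed
  ultimately show thesis by (rule that)
qed

text \<open>If the amplitudes of the sign pattern have a single nonzero entry for every choice of row
  signs, then n = 2 and all arms have the length of the right-hand side. Instead of being collinear,
  the two arms then form with the right-hand side an isosceles triangle with sides 5/6, 5/6, 1,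
  oppositely oriented in the two rows. There the linearisation is invertible.\<close>

lemma delay_solvable_isosceles:
  fixes \<beta> :: "nat \<Rightarrow> nat \<Rightarrow> real" and \<omega> c :: "nat \<Rightarrow> real"
  assumes indep: "rat_independent_family \<omega> {..<2}"
    and \<omega>: "\<forall>m<2. \<omega> m > 0"
    and \<beta>c: "\<forall>m<2. \<forall>k<2. \<bar>\<beta> m k * c k\<bar> = \<omega> m"
  shows "delay_solvable 2 \<beta> \<omega>"
proof -
  \<comment> \<open>Half the base, the height and the leg of the triangle are \<open>1/2\<close>,
    \<open>2/3\<close>, \<open>5/6\<close>, a right triangle 3-4-5 divided by 6; so all coordinates
    are rational. The arms \<open>u\<close> are measured in units of
    \<open>\<i> * \<omega> m\<close>.\<close>
  define a where "a k = 5 / 6 * c k" for k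
  define u where "u m k = Complex (1/2) (if m = k then 2/3 else - 2/3)" for m k :: nat
  define Z where "Z m k = \<i> * of_real (\<omega> m) * u m k / of_real (a k * \<beta> m k)" for m k
  have \<omega>0: "\<omega> 0 > 0" and \<omega>1: "\<omega> 1 > 0" using \<omega> by auto
  define s where "s = \<omega> 0 + \<omega> 1"
  have "s > 0" using \<omega>0 \<omega>1 by (simp add: s_def)
  have nz: "a k \<noteq> 0" "\<beta> m k \<noteq> 0" if "m < 2" "k < 2" for m k
  proof -
    have "\<bar>\<beta> m k * c k\<bar> > 0" using \<beta>c \<omega> that by simp
    then show "a k \<noteq> 0" "\<beta> m k \<noteq> 0" by (auto simp: a_def)
  qed
  have "sqrt (25 / 36) = 5 / 6" by (rule real_sqrt_unique) (simp_all add: power2_eq_square)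
  then have nu: "norm (u m k) = 5 / 6" for m k
    by (simp add: u_def norm_complex_def power2_eq_square)
  define w where "w q m = q m / (\<i> * of_real (\<omega> m))" for q :: "nat \<Rightarrow> complex" and m
  \<comment> \<open>After division by \<open>a k\<close>, the increments enter through sums and
    differences: \<open>P\<close> and \<open>R\<close> for \<open>x\<close>, \<open>U\<close> and
    \<open>Q\<close> for \<open>v\<close>. Real parts give a 2 by 2 system for \<open>P\<close> and
    \<open>Q\<close>, imaginary parts one for \<open>R\<close> and \<open>U\<close>. With the
    opposite orientations of the two rows both determinants are \<open>s / 3\<close>, which is
    positive.\<close>
  define Q where "Q q = 3 / 2 * (Re (w q 1) - Re (w q 0)) / s" for q
  define P where "P q = 2 * (\<omega> 1 * Re (w q 0) + \<omega> 0 * Re (w q 1)) / s" for q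
  define U where "U q = 2 * (Im (w q 0) + Im (w q 1)) / s" for q
  define R where "R q = 3 / 2 * (\<omega> 1 * Im (w q 0) - \<omega> 0 * Im (w q 1)) / s" for q
  define sg where "sg k = (if k = 0 then 1 else - 1 :: real)" for k :: nat
  define X where "X q k = a k * ((P q + sg k * R q) / 2)" for q k
  define V where "V q k = a k * ((U q + sg k * Q q) / 2)" for q k
  have sg: "sg 0 * t = t" "sg 1 * t = - t" for t by (simp_all add: sg_def)
  have sum2: "(\<Sum>k<2. f k) = f 0 + f 1" for f :: "nat \<Rightarrow> complex"
    by (simp add: numeral_2_eq_2)
  have w_diff: "w (\<lambda>m. p m - q m) m = w p m - w q m" for p q m
    by (simp add: w_def diff_divide_distrib)
  have PQRU_diff: "P (\<lambda>m. p m - q m) = P p - P q" "Q (\<lambda>m. p m - q m) = Q p - Q q"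
    "R (\<lambda>m. p m - q m) = R p - R q" "U (\<lambda>m. p m - q m) = U p - U q" for p q
    using \<open>s > 0\<close> by (simp_all add: P_def Q_def R_def U_def w_diff field_simps)
  define K where "K = 1 / \<omega> 0 + 1 / \<omega> 1"
  define B where "B = (2 + 4 / s) * K"
  have "K \<ge> 0" using \<omega>0 \<omega>1 by (simp add: K_def)
  have PQRU: "\<bar>P q\<bar> \<le> B * d" "\<bar>Q q\<bar> \<le> B * d" "\<bar>R q\<bar> \<le> B * d" "\<bar>U q\<bar> \<le> B * d"
    if q: "\<forall>m<2. norm (q m) \<le> d" for q d
  proof -
    have "d \<ge> 0" using q[rule_format, of 0] norm_ge_zero[of "q 0"] by linarith
    define e where "e = K * d"
    have "e \<ge> 0" using \<open>K \<ge> 0\<close> \<open>d \<ge> 0\<close> by (simp add: e_def)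
    have nw: "norm (w q m) \<le> e" if "m < 2" for m
    proof -
      have "norm (w q m) = norm (q m) * (1 / \<omega> m)"
        using \<omega>[rule_format, OF that] by (simp add: w_def norm_divide norm_mult)
      also have "\<dots> \<le> d * K"
        using q \<omega> that \<open>d \<ge> 0\<close> \<omega>0 \<omega>1 by (intro mult_mono) (auto simp: K_def less_2_cases_iff)
      finally show ?thesis by (simp add: e_def mult.commute)
    qed
    have Re: "\<bar>Re (w q 0)\<bar> \<le> e" "\<bar>Re (w q 1)\<bar> \<le> e" and Im: "\<bar>Im (w q 0)\<bar> \<le> e" "\<bar>Im (w q 1)\<bar> \<le> e"
      using nw[of 0] nw[of 1] abs_Re_le_cmod abs_Im_le_cmod order_trans by fastforce+
    have e_s: "4 * e / s \<ge> 0" using \<open>e \<ge> 0\<close> \<open>s > 0\<close> by simp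
    have Be: "B * d = 2 * e + 4 * e / s" using \<open>s > 0\<close> by (simp add: B_def e_def field_simps)
    have comb: "\<bar>\<omega> 1 * x + \<omega> 0 * y\<bar> \<le> s * e" if "\<bar>x\<bar> \<le> e" "\<bar>y\<bar> \<le> e" for x y
    proof -
      have "\<bar>\<omega> 1 * x + \<omega> 0 * y\<bar> \<le> \<omega> 1 * \<bar>x\<bar> + \<omega> 0 * \<bar>y\<bar>"
        using abs_triangle_ineq[of "\<omega> 1 * x" "\<omega> 0 * y"] \<omega>0 \<omega>1 by (simp add: abs_mult)
      also have "\<dots> \<le> \<omega> 1 * e + \<omega> 0 * e" using that \<omega>0 \<omega>1 by (intro add_mono mult_left_mono) auto
      finally show ?thesis by (simp add: s_def algebra_simps)
    qed
    have abs_frac: "\<bar>t * x / s\<bar> = t * \<bar>x\<bar> / s" if "t \<ge> 0" for t x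
      using that \<open>s > 0\<close> by (simp add: abs_mult)
    have "\<bar>P q\<bar> = 2 * \<bar>\<omega> 1 * Re (w q 0) + \<omega> 0 * Re (w q 1)\<bar> / s"
      unfolding P_def by (rule abs_frac) simp
    also have "\<dots> \<le> 2 * (s * e) / s"
      using comb[OF Re] \<open>s > 0\<close> by (intro divide_right_mono) auto
    also have "\<dots> = 2 * e" using \<open>s > 0\<close> by simp
    finally show "\<bar>P q\<bar> \<le> B * d" using e_s unfolding Be by linarith
    have "\<bar>R q\<bar> = 3 / 2 * \<bar>\<omega> 1 * Im (w q 0) - \<omega> 0 * Im (w q 1)\<bar> / s"
      unfolding R_def by (rule abs_frac) simp
    also have "\<dots> \<le> 2 * (s * e) / s"
      using comb[of "Im (w q 0)" "- Im (w q 1)"] Im \<open>s > 0\<close> \<open>e \<ge> 0\<close>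
      by (intro divide_right_mono mult_mono) auto
    also have "\<dots> = 2 * e" using \<open>s > 0\<close> by simp
    finally show "\<bar>R q\<bar> \<le> B * d" using e_s unfolding Be by linarith
    have "\<bar>Q q\<bar> = 3 / 2 * \<bar>Re (w q 1) - Re (w q 0)\<bar> / s"
      unfolding Q_def by (rule abs_frac) simp
    also have "\<dots> \<le> 4 * e / s"
    proof (rule divide_right_mono)
      have "\<bar>Re (w q 1) - Re (w q 0)\<bar> \<le> 2 * e" using Re by linarith
      then show "3 / 2 * \<bar>Re (w q 1) - Re (w q 0)\<bar> \<le> 4 * e" using \<open>e \<ge> 0\<close> by simp
    qed (use \<open>s > 0\<close> in simp)
    finally show "\<bar>Q q\<bar> \<le> B * d" using \<open>e \<ge> 0\<close> unfolding Be by linarith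
    have "\<bar>U q\<bar> = 2 * \<bar>Im (w q 0) + Im (w q 1)\<bar> / s"
      unfolding U_def by (rule abs_frac) simp
    also have "\<dots> \<le> 4 * e / s"
    proof (rule divide_right_mono)
      have "\<bar>Im (w q 0) + Im (w q 1)\<bar> \<le> 2 * e" using Im by linarith
      then show "2 * \<bar>Im (w q 0) + Im (w q 1)\<bar> \<le> 4 * e" by simp
    qed (use \<open>s > 0\<close> in simp)
    finally show "\<bar>U q\<bar> \<le> B * d" using \<open>e \<ge> 0\<close> unfolding Be by linarith
  qed
  have rows: "u m 0 * Complex ((P q + R q) / 2) (\<omega> m * ((U q + Q q) / 2))
      + u m 1 * Complex ((P q - R q) / 2) (\<omega> m * ((U q - Q q) / 2)) = w q m" if "m < 2" for q m
  proof -
    have "P q / 2 - 2/3 * \<omega> 0 * Q q = Re (w q 0)" "2/3 * R q + \<omega> 0 * U q / 2 = Im (w q 0)"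
      "P q / 2 + 2/3 * \<omega> 1 * Q q = Re (w q 1)" "- 2/3 * R q + \<omega> 1 * U q / 2 = Im (w q 1)"
      using \<open>s > 0\<close> by (simp_all add: P_def Q_def R_def U_def field_simps) (simp_all add: s_def algebra_simps)
    then show ?thesis
      using that by (auto simp: less_2_cases_iff u_def complex_eq_iff field_simps)
  qed
  show ?thesis
    unfolding delay_solvable_def
  proof (rule delay_system_solvable[of \<omega> 2 Z a \<beta> X V "(\<bar>a 0\<bar> + \<bar>a 1\<bar>) * B"])
    show "\<forall>m<2. \<forall>k<2. norm (Z m k) = 1"
    proof (intro allI impI)
      fix m k :: nat assume "m < 2" "k < 2"
      have "\<bar>a k * \<beta> m k\<bar> = 5 / 6 * \<omega> m"
        using \<beta>c \<open>m < 2\<close> \<open>k < 2\<close> by (auto simp: a_def abs_mult mult.commute)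
      then show "norm (Z m k) = 1"
        using \<omega> \<open>m < 2\<close> unfolding Z_def norm_divide norm_mult norm_of_real nu by auto
    qed
    show "\<forall>m<2. (\<Sum>k<2. of_real (a k * \<beta> m k) * Z m k) = \<i> * of_real (\<omega> m)"
    proof (intro allI impI)
      fix m :: nat assume "m < 2"
      have "(\<Sum>k<2. of_real (a k * \<beta> m k) * Z m k) = (\<Sum>k<2. \<i> * of_real (\<omega> m) * u m k)"
        using nz \<open>m < 2\<close> by (intro sum.cong) (auto simp: Z_def)
      also have "\<dots> = \<i> * of_real (\<omega> m) * (u m 0 + u m 1)"
        by (simp only: sum2 distrib_left)
      also have "u m 0 + u m 1 = 1"
        using \<open>m < 2\<close> by (auto simp: u_def complex_eq_iff less_2_cases_iff)
      finally show "(\<Sum>k<2. of_real (a k * \<beta> m k) * Z m k) = \<i> * of_real (\<omega> m)" by simp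
    qed
    show "X (\<lambda>m. p m - q m) k = X p k - X q k" "V (\<lambda>m. p m - q m) k = V p k - V q k" for p q k
      by (simp_all add: X_def V_def PQRU_diff algebra_simps diff_divide_distrib add_divide_distrib)
    show "\<bar>X q k\<bar> \<le> (\<bar>a 0\<bar> + \<bar>a 1\<bar>) * B * d \<and> \<bar>V q k\<bar> \<le> (\<bar>a 0\<bar> + \<bar>a 1\<bar>) * B * d"
      if q: "\<forall>m<2. norm (q m) \<le> d" and "k < 2" for q d k
    proof -
      have "\<bar>(P q + sg k * R q) / 2\<bar> \<le> B * d" "\<bar>(U q + sg k * Q q) / 2\<bar> \<le> B * d"
        using PQRU[OF q] by (auto simp: sg_def)
      moreover have "\<bar>a k\<bar> \<le> \<bar>a 0\<bar> + \<bar>a 1\<bar>" using \<open>k < 2\<close> by (auto simp: less_2_cases_iff)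
      ultimately have "\<bar>X q k\<bar> \<le> (\<bar>a 0\<bar> + \<bar>a 1\<bar>) * (B * d)" "\<bar>V q k\<bar> \<le> (\<bar>a 0\<bar> + \<bar>a 1\<bar>) * (B * d)"
        unfolding X_def V_def abs_mult[of "a k"] by - (rule mult_mono, assumption, assumption, simp, simp)+
      then show ?thesis by (simp add: mult.assoc)
    qed
    \<comment> \<open>Here \<open>X\<close> and \<open>V\<close> invert the linearisation exactly,
      so the difference is 0.\<close>
    show "norm (q m - (\<Sum>k<2. of_real (\<beta> m k) * Z m k * (of_real (X q k) + \<i> * of_real (\<omega> m * V q k)))) \<le> d / 4"
      if q: "\<forall>m<2. norm (q m) \<le> d" and "m < 2" for q d m
    proof -
      have "d \<ge> 0" using q[rule_format, of 0] norm_ge_zero[of "q 0"] by linarith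
      have "(\<Sum>k<2. of_real (\<beta> m k) * Z m k * (of_real (X q k) + \<i> * of_real (\<omega> m * V q k)))
          = (\<Sum>k<2. \<i> * of_real (\<omega> m) * (u m k * Complex ((P q + sg k * R q) / 2) (\<omega> m * ((U q + sg k * Q q) / 2))))"
      proof (intro sum.cong refl)
        fix k :: nat assume "k \<in> {..<2}"
        then have "k < 2" by simp
        have "of_real (\<beta> m k) * Z m k = \<i> * of_real (\<omega> m) * u m k / of_real (a k)"
          using nz[OF \<open>m < 2\<close> \<open>k < 2\<close>] by (simp add: Z_def)
        moreover have "of_real (X q k) + \<i> * of_real (\<omega> m * V q k)
            = of_real (a k) * Complex ((P q + sg k * R q) / 2) (\<omega> m * ((U q + sg k * Q q) / 2))"
          by (simp add: X_def V_def complex_eq_iff)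
        ultimately show "of_real (\<beta> m k) * Z m k * (of_real (X q k) + \<i> * of_real (\<omega> m * V q k))
            = \<i> * of_real (\<omega> m) * (u m k * Complex ((P q + sg k * R q) / 2) (\<omega> m * ((U q + sg k * Q q) / 2)))"
          using nz[OF \<open>m < 2\<close> \<open>k < 2\<close>] by simp
      qed
      also have "\<dots> = \<i> * of_real (\<omega> m) * (u m 0 * Complex ((P q + R q) / 2) (\<omega> m * ((U q + Q q) / 2))
          + u m 1 * Complex ((P q - R q) / 2) (\<omega> m * ((U q - Q q) / 2)))"
        by (simp only: sum2 sg distrib_left add_uminus_conv_diff)
      also have "\<dots> = \<i> * of_real (\<omega> m) * w q m" by (simp only: rows[OF \<open>m < 2\<close>])
      also have "\<dots> = q m"
        using \<omega> \<open>m < 2\<close> by (auto simp: w_def)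
      finally show ?thesis using \<open>d \<ge> 0\<close> by simp
    qed
  qed (use indep nz in auto)
qed

text \<open>A single row has one arm, whose amplitude cannot vanish, so the sign pattern itself
  serves. From two rows on, \<open>two_nonzero_amplitudes_or_degenerate\<close> decides between
  perturbing the pattern and the isosceles configuration.\<close>

lemma delay_solvable_if_sign_pattern_invertible:
  fixes \<beta> M N :: "nat \<Rightarrow> nat \<Rightarrow> real" and \<omega> :: "nat \<Rightarrow> real"
  assumes indep: "rat_independent_family \<omega> {..<n}"
    and \<omega>: "\<forall>m<n. \<omega> m > 0"
    and \<beta>: "\<forall>m<n. \<forall>k<n. \<beta> m k \<noteq> 0"
    and M: "\<forall>m<n. \<forall>k<n. \<bar>M m k\<bar> = \<bar>\<beta> m k\<bar>"
    and MN: "\<And>m u. m < n \<Longrightarrow> (\<Sum>k<n. M m k * (\<Sum>l<n. N k l * u l)) = u m"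
    and N: "\<forall>k<n. \<exists>l<n. N k l \<noteq> 0"
  shows "delay_solvable n \<beta> \<omega>"
proof -
  obtain \<epsilon> where "\<epsilon> > 0" and near:
    "\<And>a (E :: nat \<Rightarrow> nat \<Rightarrow> complex). \<lbrakk>\<forall>k<n. a k \<noteq> 0; \<forall>m<n. \<forall>k<n. norm (E m k) = 1 \<and> norm (E m k - 1) \<le> \<epsilon>;
       \<forall>m<n. norm (\<Sum>k<n. of_real (M m k * a k) * E m k) = \<omega> m\<rbrakk> \<Longrightarrow> delay_solvable n \<beta> \<omega>"
    using delay_solvable_near_sign_pattern[OF indep \<omega> \<beta> M MN] by blast
  have M0: "\<forall>m<n. \<forall>k<n. M m k \<noteq> 0" using M \<beta> by (metis abs_0 abs_eq_0)
  consider "n = 0" | "n = 1" | "n \<ge> 2" by linarith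
  then show ?thesis
  proof cases
    case 1
    then show ?thesis by (simp add: delay_solvable_def)
  next
    case 2
    have "M 0 0 * (N 0 0 * \<omega> 0) = \<omega> 0" using MN[of 0 \<omega>] 2 by simp
    then obtain a where "M 0 0 * a = \<omega> 0" by blast
    moreover have "\<omega> 0 > 0" using \<omega> 2 by simp
    ultimately show ?thesis
      using 2 \<open>\<epsilon> > 0\<close> by (intro near[of "\<lambda>_. a" "\<lambda>_ _. 1"]) (auto simp del: of_real_mult)
  next
    case 3
    show ?thesis
    proof (rule two_nonzero_amplitudes_or_degenerate[OF MN M0 \<omega> 3])
      fix y i j
      assume y: "\<forall>m<n. \<bar>y m\<bar> = \<omega> m" and ij: "i < n" "j < n" "i \<noteq> j"
        "(\<Sum>l<n. N i l * y l) \<noteq> 0" "(\<Sum>l<n. N j l * y l) \<noteq> 0"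
      have "\<forall>m<n. y m \<noteq> 0" using y \<omega> by fastforce
      from perturb_to_nonzero_amplitudes[OF MN N M0 this ij \<open>\<epsilon> > 0\<close>] obtain a E
        where "\<forall>k<n. a k \<noteq> 0" "\<forall>m<n. \<forall>k<n. norm (E m k) = 1 \<and> norm (E m k - 1) \<le> \<epsilon>"
          and row: "\<forall>m<n. norm (\<Sum>k<n. complex_of_real (M m k * a k) * E m k) = \<bar>y m\<bar>"
        by blast
      moreover have "\<forall>m<n. norm (\<Sum>k<n. complex_of_real (M m k * a k) * E m k) = \<omega> m"
        using row y by (simp del: of_real_mult)
      ultimately show ?thesis by (intro near[of a E])
    next
      fix k0 k1 c0 c1
      assume "n = 2" and k: "k0 < 2" "k1 < 2" "k0 \<noteq> k1"
        and M_col: "M 0 k0 * c0 = \<omega> 0" "M 1 k0 * c0 = \<omega> 1" "M 0 k1 * c1 = - \<omega> 0" "M 1 k1 * c1 = \<omega> 1"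
      define c where "c k = (if k = k0 then c0 else c1)" for k
      have "\<omega> 0 > 0" "\<omega> 1 > 0" using \<omega> \<open>n = 2\<close> by simp_all
      have "\<bar>M m k * c k\<bar> = \<omega> m" if "m < 2" "k < 2" for m k
      proof -
        have "k = k0 \<or> k = k1" using k that by linarith
        moreover have "m = 0 \<or> m = 1" using that by linarith
        ultimately show ?thesis
          using k(3) M_col \<open>\<omega> 0 > 0\<close> \<open>\<omega> 1 > 0\<close> by (elim disjE) (simp_all add: c_def)
      qed
      then have "\<forall>m<2. \<forall>k<2. \<bar>\<beta> m k * c k\<bar> = \<omega> m"
        using M \<open>n = 2\<close> by (simp add: abs_mult)
      then show ?thesis using delay_solvable_isosceles[of \<omega> \<beta> c] indep \<omega> \<open>n = 2\<close> by simp
    qed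
  qed
qed

section \<open>Rows of \<open>I_B\<close> and transfer to the flattened system\<close>

lemma rat_independent_family_reindex:
  assumes "rat_independent_family x S" "bij_betw f T S"
  shows "rat_independent_family (x \<circ> f) T"
proof -
  have "(x \<circ> f) ` T = x ` S" using assms(2) by (simp only: image_comp[symmetric] bij_betw_def)
  moreover have "inj_on (x \<circ> f) T"
    using assms by (auto simp: rat_independent_family_def bij_betw_def intro: comp_inj_on)
  ultimately show ?thesis
    using assms(1) by (simp add: rat_independent_family_def del: image_comp)
qed

text \<open>The pairs \<open>(j, l)\<close> in the order in which \<open>I_B\<close> stacks its
  rows: position \<open>m\<close> names the equation assigned to matrix row
  \<open>m\<close>.\<close>

definition row_labels :: "(nat \<Rightarrow> nat) \<Rightarrow> nat list \<Rightarrow> (nat \<times> nat) list" where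
  "row_labels ell js = concat (map (\<lambda>j. map (Pair j) [1..<ell j + 1]) js)"

lemma set_row_labels: "set (row_labels ell js) = (SIGMA j:set js. {1..ell j})"
  by (force simp: row_labels_def)

lemma distinct_row_labels: "distinct js \<Longrightarrow> distinct (row_labels ell js)"
  by (induction js) (auto simp: row_labels_def distinct_map inj_on_def)

text \<open>Pairing two lists with the same block structure avoids arithmetic with block boundaries.
  Moduli are recorded because a sign is a phase and is left to the delays.\<close>

lemma sign_block_rows_labelled:
  "list_all2 (\<lambda>v (j, l). dim_vec v = n \<and> (\<forall>k<n. \<bar>vec_index v k\<bar> = \<bar>b j (k + 1)\<bar>))
     (concat (map (\<lambda>j. Matrix.rows (sign_block n ell b j)) js)) (row_labels ell js)"
proof (induction js)
  case Nil
  then show ?case by (simp add: row_labels_def)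
next
  case (Cons j js)
  have "list_all2 (\<lambda>v (j, l). dim_vec v = n \<and> (\<forall>k<n. \<bar>vec_index v k\<bar> = \<bar>b j (k + 1)\<bar>))
     (Matrix.rows (sign_block n ell b j)) (map (Pair j) [1..<ell j + 1])"
    by (auto simp: list_all2_conv_all_nth sign_block_def Let_def simp del: upt_Suc)
  from list_all2_appendI[OF this Cons.IH] show ?case
    unfolding row_labels_def by (simp only: list.map concat.simps)
qed

lemma abs_I_B_entry:
  assumes "n = block_end ell r" "m < n" "k < n"
  shows "\<bar>I_B r ell b $$ (m, k)\<bar> = \<bar>b (fst (row_labels ell [1..<r + 1] ! m)) (k + 1)\<bar>"
proof -
  define rs where "rs = concat (map (\<lambda>j. Matrix.rows (sign_block n ell b j)) [1..<r + 1])"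
  have I: "I_B r ell b = mat_of_rows n rs"
    using assms(1) by (simp add: I_B_def rs_def Let_def)
  then have "m < length rs"
    using I_B_carrier[of r ell b] assms by auto
  then have "\<bar>vec_index (rs ! m) k\<bar> = \<bar>b (fst (row_labels ell [1..<r + 1] ! m)) (k + 1)\<bar>"
    using list_all2_nthD[OF sign_block_rows_labelled[of n b ell "[1..<r + 1]"], of m] assms(3)
    unfolding rs_def by (auto simp: split_beta)
  then show ?thesis
    using \<open>m < length rs\<close> assms(3) by (simp add: I mat_of_rows_index)
qed

lemma bij_betw_row_labels:
  "bij_betw ((!) (row_labels ell [1..<r + 1])) {..<block_end ell r} (SIGMA j:{1..r}. {1..ell j})"
proof -
  have "length (row_labels ell [1..<r + 1]) = sum_list (map ell [1..<r + 1])"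
    by (simp add: row_labels_def length_concat comp_def del: upt_Suc)
  also have "\<dots> = block_end ell r"
    unfolding interv_sum_list_conv_sum_set_nat block_end_def by (rule sum.cong) auto
  finally have len: "length (row_labels ell [1..<r + 1]) = block_end ell r" .
  have "set (row_labels ell [1..<r + 1]) = (SIGMA j:{1..r}. {1..ell j})"
    by (auto simp: set_row_labels)
  then show ?thesis
    using distinct_row_labels[of "[1..<r + 1]" ell] len by (intro bij_betw_nth) auto
qed

text \<open>The inverse \<open>B\<close> as a right inverse gives the first property, as a left
  inverse the second: a zero row \<open>k\<close> of \<open>B\<close> would make the diagonal entry
  \<open>k\<close> of \<open>B * A\<close> zero.\<close>

lemma nonsingular_matrix_inverse_entries:
  fixes A :: "real mat"
  assumes A: "A \<in> carrier_mat n n" and "Determinant.det A \<noteq> 0"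
  obtains N where "\<And>m u. m < n \<Longrightarrow> (\<Sum>k<n. A $$ (m, k) * (\<Sum>l<n. N k l * u l)) = u m"
    "\<forall>k<n. \<exists>l<n. N k l \<noteq> 0"
proof -
  obtain B where B: "B \<in> carrier_mat n n" and BA: "B * A = 1\<^sub>m n" and AB: "A * B = 1\<^sub>m n"
    using det_non_zero_imp_unit[OF assms, unfolded Units_def, of "()"] by (auto simp: ring_mat_def)
  have entry: "(C * D) $$ (i, j) = (\<Sum>k<n. C $$ (i, k) * D $$ (k, j))"
    if "C \<in> carrier_mat n n" "D \<in> carrier_mat n n" "i < n" "j < n" for C D :: "real mat" and i j
    using that by (auto simp: scalar_prod_def atLeast0LessThan intro!: sum.cong)
  show thesis
  proof (rule that[of "\<lambda>k l. B $$ (k, l)"])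
    fix m and u :: "nat \<Rightarrow> real" assume "m < n"
    have "(\<Sum>k<n. A $$ (m, k) * (\<Sum>l<n. B $$ (k, l) * u l)) = (\<Sum>k<n. \<Sum>l<n. A $$ (m, k) * B $$ (k, l) * u l)"
      by (simp add: sum_distrib_left mult.assoc)
    also have "\<dots> = (\<Sum>l<n. \<Sum>k<n. A $$ (m, k) * B $$ (k, l) * u l)"
      by (rule sum.swap)
    also have "\<dots> = (\<Sum>l<n. (A * B) $$ (m, l) * u l)"
      using \<open>m < n\<close> by (simp add: entry[OF A B] sum_distrib_right)
    also have "\<dots> = (\<Sum>l<n. if m = l then u l else 0)"
      unfolding AB using \<open>m < n\<close> by (intro sum.cong) auto
    also have "\<dots> = u m" using \<open>m < n\<close> by simp
    finally show "(\<Sum>k<n. A $$ (m, k) * (\<Sum>l<n. B $$ (k, l) * u l)) = u m" .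
  next
    show "\<forall>k<n. \<exists>l<n. B $$ (k, l) \<noteq> 0"
    proof (intro allI impI, rule ccontr)
      fix k assume "k < n" and "\<not> (\<exists>l<n. B $$ (k, l) \<noteq> 0)"
      then have "(B * A) $$ (k, k) = 0" by (simp add: entry[OF B A])
      with \<open>k < n\<close> show False by (simp add: BA)
    qed
  qed
qed

theorem theorem2p4:
  fixes r n :: nat and ell :: "nat \<Rightarrow> nat"
    and b \<omega> :: "nat \<Rightarrow> nat \<Rightarrow> real"
  assumes "r \<ge> 1"
    and "\<forall>j\<in>{1..r}. ell j \<ge> 1"
    and "n = (\<Sum>j=1..r. ell j)"
    and "\<forall>j\<in>{1..r}. \<forall>k\<in>{1..n}. b j k \<noteq> 0"
    and "Determinant.det (I_B r ell b) \<noteq> 0"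
    and "\<forall>j\<in>{1..r}. \<forall>l\<in>{1..ell j}. \<omega> j l > 0"
    and "rat_independent_family (\<lambda>(j, l). \<omega> j l) (SIGMA j:{1..r}. {1..ell j})"
  shows "\<exists>(\<tau> :: nat \<Rightarrow> real) (a :: nat \<Rightarrow> real).
           (\<forall>k\<in>{1..n}. \<tau> k > 0) \<and>
           (\<forall>j\<in>{1..r}. \<forall>l\<in>{1..ell j}.
              char_factor n a (b j) \<tau> (\<i> * complex_of_real (\<omega> j l)) = 0)"
proof -
  define label where "label m = row_labels ell [1..<r + 1] ! m" for m
  \<comment> \<open>All rows of block \<open>j\<close> share the coefficients of factor
    \<open>j\<close>; the second component of a label only selects the frequency. The shift passes
    from 0-based columns to the 1-based \<open>b\<close>.\<close>
  define \<beta> where "\<beta> m k = b (fst (label m)) (k + 1)" for m k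
  define x where "x = (\<lambda>(j, l). \<omega> j l) \<circ> label"
  have n: "n = block_end ell r" using assms(3) by (simp add: block_end_def)
  have bij: "bij_betw label {..<n} (SIGMA j:{1..r}. {1..ell j})"
    using bij_betw_row_labels[of ell r] by (simp add: label_def[abs_def] n)
  then have label: "label m \<in> (SIGMA j:{1..r}. {1..ell j})" if "m < n" for m
    using that by (auto dest!: bij_betw_imp_surj_on)
  obtain N where N: "\<And>m u. m < n \<Longrightarrow> (\<Sum>k<n. I_B r ell b $$ (m, k) * (\<Sum>l<n. N k l * u l)) = u m"
    "\<forall>k<n. \<exists>l<n. N k l \<noteq> 0"
    using nonsingular_matrix_inverse_entries[OF I_B_carrier assms(5)] unfolding n by blast
  have "delay_solvable n \<beta> x"
  proof (rule delay_solvable_if_sign_pattern_invertible[OF _ _ _ _ N])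
    show "rat_independent_family x {..<n}"
      unfolding x_def by (rule rat_independent_family_reindex[OF assms(7) bij])
    show "\<forall>m<n. x m > 0" "\<forall>m<n. \<forall>k<n. \<beta> m k \<noteq> 0"
      using label assms(4,6) by (fastforce simp: x_def \<beta>_def)+
    show "\<forall>m<n. \<forall>k<n. \<bar>I_B r ell b $$ (m, k)\<bar> = \<bar>\<beta> m k\<bar>"
      using abs_I_B_entry[OF n] by (simp add: \<beta>_def label_def)
  qed
  then obtain \<tau> c where \<tau>: "\<forall>k<n. \<tau> k > 0" and sol:
    "\<forall>m<n. (\<Sum>k<n. of_real (c k * \<beta> m k) * exp (- (\<i> * of_real (x m * \<tau> k)))) = \<i> * of_real (x m)"
    unfolding delay_solvable_def by blast
  show ?thesis
  proof (intro exI conjI ballI)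
    show "\<tau> (k - 1) > 0" if "k \<in> {1..n}" for k using \<tau> that by auto
    fix j l assume "j \<in> {1..r}" "l \<in> {1..ell j}"
    then obtain m where "m < n" and m: "label m = (j, l)"
      using bij unfolding bij_betw_def by (metis (no_types, lifting) SigmaI imageE lessThan_iff)
    have x_m: "x m = \<omega> j l" by (simp add: x_def m)
    have "(\<Sum>k=1..n. of_real (c (k - 1)) * of_real (b j k) * exp (- (\<i> * of_real (\<omega> j l)) * of_real (\<tau> (k - 1))))
        = (\<Sum>k<n. of_real (c k * \<beta> m k) * exp (- (\<i> * of_real (x m * \<tau> k))))"
      by (simp add: sum.atLeast1_atMost_eq \<beta>_def x_m m mult.assoc)
    also have "\<dots> = \<i> * of_real (\<omega> j l)" using sol \<open>m < n\<close> unfolding x_m[symmetric] by blast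
    finally show "char_factor n (\<lambda>k. c (k - 1)) (b j) (\<lambda>k. \<tau> (k - 1)) (\<i> * complex_of_real (\<omega> j l)) = 0"
      by (simp add: char_factor_def)
  qed
qed

end
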